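(* Let $\rho>1$, $\lambda\in\mathbb{C}$, and let $\delta_2,\delta_3>0$ be given constants. Let $I_n(R_nz;\lambda)=(1-\lambda)s_n(R_nz)-\lambda t_{n+1}(R_nz)$, where $s_n$, $t_{n+1}$ are the sections and tails of the Mittag--Leffler function $E_{1/\rho}$. Then, as $n\to\infty$, the following hold. (1) If $z=re^{i\phi}$ with $r\ge 1$, $|\phi|\le\frac{\pi}{2\rho}$, $|z-1|\ge\delta_2$, then $$\frac{I_n(R_nz;\lambda)\,\Gamma(1+\frac n\rho)}{R_n^nz^n}=-\lambda\rho\,\frac{e^{R_n^\rho z^\rho}\,\Gamma(1+\frac n\rho)}{R_n^nz^n}(1+o(1))-\frac{z}{1-z}(1+o(1)).$$ (2) If $z=re^{i\phi}$ with $0<r\le 1$, $|\phi|\le\frac{\pi}{2\rho}$, $|z-1|\ge\delta_2$, then $$\frac{I_n(R_nz;\lambda)\,\Gamma(1+\frac n\rho)}{R_n^nz^n}=(1-\lambda)\rho\,\frac{e^{R_n^\rho z^\rho}\,\Gamma(1+\frac n\rho)}{R_n^nz^n}(1+o(1))-\frac{z}{1-z}(1+o(1)).$$ (3) If $z=re^{i\phi}$ with $r>0$, $|\phi|\ge\frac{\pi}{2\rho}+\delta_3$, then $$\frac{I_n(R_nz;\lambda)\,\Gamma(1+\frac n\rho)}{R_n^nz^n}=\frac{\lambda-1}{\Gamma(1-\frac1\rho)}\,\frac{\Gamma(1+\frac n\rho)}{R_n^{n+1}z^{n+1}}(1+o(1))-\frac{z}{1-z}(1+o(1)).$$ In all the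 expressions above, the symbols $o(1)$ are uniform with respect to $z$ in the indicated set.
   Context: For $\rho>1$, $E_{1/\rho}(z)=\sum_{j=0}^\infty \frac{z^j}{\Gamma(1+j/\rho)}$ is the Mittag--Leffler function of order $\rho$. Its sections and tails are $s_n(z)=\sum_{k=0}^n\frac{z^k}{\Gamma(1+k/\rho)}$ and $t_n(z)=\sum_{k=n}^\infty\frac{z^k}{\Gamma(1+k/\rho)}$. For $n\ge1$, $R_n=\frac{\Gamma(1+n/\rho)}{\Gamma(1+(n-1)/\rho)}$. Arguments $\phi=\arg z$ are taken in $(-\pi,\pi]$ and $z^\rho=r^\rho e^{i\rho\phi}$ is the principal branch.
   Formalization: In (2) and (3) the o(1) attached to the first term is uniform only as n→∞ and R_n|z|→∞ (e.g. on |z|≥d>0), since for λ≠1 uniformity on the whole set fails at z=c/R_n; the o(1) attached to z/(1-z), and both in (1), are uniform on the full set. *)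

theory Defs
  imports "HOL-Complex_Analysis.Complex_Analysis"
begin

definition mittag_leffler :: "real \<Rightarrow> complex \<Rightarrow> complex" where
  "mittag_leffler \<rho> z = (\<Sum>k. z ^ k / of_real (Gamma (1 + real k / \<rho>)))"

definition mittag_leffler_section :: "real \<Rightarrow> nat \<Rightarrow> complex \<Rightarrow> complex" where
  "mittag_leffler_section \<rho> n z = (\<Sum>k\<le>n. z ^ k / of_real (Gamma (1 + real k / \<rho>)))"

definition mittag_leffler_tail :: "real \<Rightarrow> nat \<Rightarrow> complex \<Rightarrow> complex" where
  "mittag_leffler_tail \<rho> n z = (\<Sum>k. z ^ (n + k) / of_real (Gamma (1 + real (n + k) / \<rho>)))"

definition section_tail_comb :: "real \<Rightarrow> nat \<Rightarrow> complex \<Rightarrow> complex \<Rightarrow> complex" where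
  "section_tail_comb \<rho> n l z =
     (1 - l) * mittag_leffler_section \<rho> n z - l * mittag_leffler_tail \<rho> (n + 1) z"

definition radius_scale :: "real \<Rightarrow> nat \<Rightarrow> real" where
  "radius_scale \<rho> n = Gamma (1 + real n / \<rho>) / Gamma (1 + (real n - 1) / \<rho>)"

definition normalized_comb :: "real \<Rightarrow> nat \<Rightarrow> complex \<Rightarrow> complex \<Rightarrow> complex" where
  "normalized_comb \<rho> n l z =
     section_tail_comb \<rho> n l (of_real (radius_scale \<rho> n) * z) * of_real (Gamma (1 + real n / \<rho>))
       / (of_real (radius_scale \<rho> n) ^ n * z ^ n)"

text \<open>
  Here powr on the complex numbers is the principal branch, as the imaginary part of
  Ln lies in the half-open interval from -pi (excluded) to pi (included).
\<close>

definition exponential_term :: "real \<Rightarrow> nat \<Rightarrow> complex \<Rightarrow> complex" where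
  "exponential_term \<rho> n z =
     exp (of_real (radius_scale \<rho> n powr \<rho>) * z powr of_real \<rho>) * of_real (Gamma (1 + real n / \<rho>))
       / (of_real (radius_scale \<rho> n) ^ n * z ^ n)"

text \<open>
  An error that tends to 0 uniformly on S as n tends to infinity and R n * |z| tends to infinity.
  If R n tends to infinity, this gives uniform convergence on every subset of S that is bounded
  away from the origin, and more generally on the part of S outside discs about the origin whose
  radius shrinks more slowly than 1 / R n. If S accumulates at the origin, plain uniform
  convergence on S cannot be had for the error of the leading term: at z = c / R n the
  Mittag-Leffler function is evaluated at the fixed point c, so its asymptotics at infinity
  do not apply.
\<close>

definition uniformly_small_off_origin ::
    "(nat \<Rightarrow> real) \<Rightarrow> complex set \<Rightarrow> (nat \<Rightarrow> complex \<Rightarrow> complex) \<Rightarrow> bool" where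
  "uniformly_small_off_origin R S e \<longleftrightarrow>
     (\<forall>\<epsilon>>0. \<exists>M. \<forall>\<^sub>F n in sequentially. \<forall>z\<in>S. M \<le> R n * norm z \<longrightarrow> norm (e n z) < \<epsilon>)"

end

theory Submission
  imports Defs "HOL-Real_Asymp.Real_Asymp"
begin

text \<open>
  Write \<open>w = R\<^sub>n z\<close>. As \<open>E = s\<^sub>n + t\<^sub>n\<^sub>+\<^sub>1\<close>, the combination equals both
  \<open>(1 - \<lambda>) E - t\<^sub>n\<^sub>+\<^sub>1\<close>, used for \<open>|z| \<le> 1\<close>, and \<open>s\<^sub>n - \<lambda> E\<close>, used for \<open>|z| \<ge> 1\<close>.
  After normalization the tail is \<open>\<Sum> a\<^sub>k z\<^sup>k\<close> and the section is \<open>\<Sum> a\<^sub>k z\<^sup>-\<^sup>k\<close>, where by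
  log-convexity of the Gamma function the coefficients decrease from 1 with
  increasing relative decrements \<open>d\<^sub>k\<close>. Summing by parts twice shows that such a series is
  close to a geometric series away from 1: the coefficients fall to nearly 0 within
  \<open>\<epsilon> n\<close> steps, during which \<open>d\<^sub>k\<close> is still small.

  The asymptotics of \<open>E\<close> itself come from Hankel's formula in the coordinate \<open>u = log \<zeta>\<close>:
  \<open>E(z)\<close> is the limit of \<open>1/(2\<pi>i) \<integral> exp(e\<^sup>u) / (1 - z e\<^sup>-\<^sup>u\<^sup>/\<^sup>\<rho>) du\<close> over vertical segments
  of half-height \<open>\<theta> \<in> (\<pi>/2, \<pi>]\<close> moving to the right. Moving the segment to the left
  instead crosses at most one pole, whose residue is \<open>\<rho> exp(z\<^sup>\<rho>)\<close>, and leaves an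
  explicitly bounded integral over two horizontal lines.
\<close>

section \<open>Geometric series with slowly decaying weights\<close>

text \<open>A single summation by parts is not enough: the decrements \<open>a k - a (Suc k)\<close>
  add up to 1, so only their own slow variation makes the error small. In the coordinate u the
  fractional power in the kernel becomes an entire exponential, so no branch cut remains. Compact
  segments let the residue theorem act on rectangles, and the only improper integral left is that of
  Gamma. The horizontal lines must lie where \<open>cos (Im u)\<close> is negative and must avoid
  the zeros of the kernel's denominator. In the closed exponential sector the height \<pi> does
  both, uniformly up to the bounding rays. Off the sector the height depends on the angular gap and
  keeps every zero outside. The third claim has an obstacle of its own: for |z| > 1 the section form
  yields the coefficient \<lambda> where the claim has \<lambda> - 1. There the whole term is
  negligible against z/(1 - z), and the discrepancy goes into the second error.\<close>

text \<open>The remainder is \<open>r = - B\<close>, with \<open>B\<close> the power series of the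
  decrements \<open>b k = a k * d k\<close>. As \<open>d\<close> increases, \<open>b\<close> can
  fall at step k by at most \<open>b k * d k\<close>, so the total variation of \<open>b\<close>
  exceeds its net change by at most twice the sum of these products. The factor \<zeta> in front of
  \<open>r\<close> keeps the error relative once the constant term is removed.\<close>

lemma damped_geometric_series:
  fixes a d :: "nat \<Rightarrow> real" and \<zeta> :: complex
  assumes a0: "a 0 = 1" and step: "\<And>k. a (Suc k) = a k * (1 - d k)"
    and d: "mono d" "\<And>k. 0 \<le> d k" "\<And>k. d k \<le> 1"
    and sum: "summable a" and \<zeta>: "norm \<zeta> \<le> 1"
  obtains r where "(1 - \<zeta>) * (\<Sum>k. of_real (a k) * \<zeta> ^ k) = 1 + \<zeta> * r"
    "norm ((1 - \<zeta>) * r) \<le> 2 * (d K + a K)"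
proof -
  have a_nonneg: "0 \<le> a k" for k
    by (induction k) (auto simp: a0 step d)
  have a_le: "a k \<le> 1" for k
  proof (induction k)
    case (Suc k)
    then show ?case
      using mult_left_le[of "1 - d k" "a k"] a_nonneg[of k] d(2)[of k] by (simp add: step)
  qed (simp add: a0)
  define b where "b = (\<lambda>k. a k * d k)"
  have b_nonneg: "0 \<le> b k" and b_le: "b k \<le> a k" for k
    using a_nonneg[of k] d(2,3)[of k] by (auto simp: b_def intro: mult_left_le)
  have b_eq: "b k = a k - a (Suc k)" for k
    by (simp add: b_def step algebra_simps)
  have b_sum: "summable b"
    by (rule summable_comparison_test'[OF sum, of 0]) (use b_nonneg b_le in auto)
  have power_sum: "summable (\<lambda>k. complex_of_real (c k) * \<zeta> ^ k)"
    if c: "summable c" "\<And>k. 0 \<le> c k" for c :: "nat \<Rightarrow> real"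
    by (rule summable_comparison_test'[OF c(1), of 0])
      (use c(2) \<zeta> in \<open>auto simp: norm_mult norm_power intro!: mult_left_le power_le_one\<close>)
  have abel: "(1 - \<zeta>) * (\<Sum>k. of_real (c k) * \<zeta> ^ k)
      = of_real (c 0) - \<zeta> * (\<Sum>k. of_real (c k - c (Suc k)) * \<zeta> ^ k)"
    if c: "summable c" "\<And>k. 0 \<le> c k" for c :: "nat \<Rightarrow> real"
  proof -
    have s: "summable (\<lambda>k. complex_of_real (c k) * \<zeta> ^ k)"
      by (rule power_sum[OF c])
    have s': "summable (\<lambda>k. complex_of_real (c (Suc k)) * \<zeta> ^ k)"
      by (rule power_sum) (use c in \<open>auto simp: summable_Suc_iff\<close>)
    have "(\<Sum>k. of_real (c k) * \<zeta> ^ k) = of_real (c 0) + (\<Sum>k. of_real (c (Suc k)) * \<zeta> ^ Suc k)"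
      using suminf_split_head[OF s] by simp
    also have "(\<Sum>k. of_real (c (Suc k)) * \<zeta> ^ Suc k) = \<zeta> * (\<Sum>k. of_real (c (Suc k)) * \<zeta> ^ k)"
      using suminf_mult[OF s', of \<zeta>] by (simp add: mult_ac)
    finally have "(\<Sum>k. of_real (c k) * \<zeta> ^ k) = of_real (c 0) + \<dots>" .
    moreover have "(\<Sum>k. of_real (c k - c (Suc k)) * \<zeta> ^ k)
        = (\<Sum>k. of_real (c k) * \<zeta> ^ k) - (\<Sum>k. of_real (c (Suc k)) * \<zeta> ^ k)"
      using suminf_diff[OF s s'] by (simp add: algebra_simps)
    ultimately show ?thesis by (simp only: left_diff_distrib right_diff_distrib distrib_left) (simp add: algebra_simps)
  qed
  define B where "B = (\<Sum>k. of_real (b k) * \<zeta> ^ k)"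
  have 1: "(1 - \<zeta>) * (\<Sum>k. of_real (a k) * \<zeta> ^ k) = 1 + \<zeta> * (- B)"
    using abel[OF sum a_nonneg] by (simp add: a0 B_def b_eq)
  define e where "e = (\<lambda>k. b k - b (Suc k))"
  \<comment> \<open>This is |x - y| <= (x - y) + 2 y for nonnegative x and y, with x the gain from
    the growth of \<open>d\<close> and y the loss \<open>b k * d k\<close>. The part x - y
    telescopes, and the resulting \<open>- b 0\<close> later cancels the boundary term of the second
    summation by parts.\<close>
  have e_bound: "\<bar>e k\<bar> \<le> (b (Suc k) - b k) + 2 * (b k * d k)" for k
  proof -
    have "b (Suc k) - b k = a (Suc k) * (d (Suc k) - d k) - b k * d k"
      by (simp add: b_def step algebra_simps)
    moreover have "0 \<le> a (Suc k) * (d (Suc k) - d k)"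
      using a_nonneg d(1) by (simp add: monoD)
    moreover have "0 \<le> b k * d k" using b_nonneg d(2) by simp
    ultimately show ?thesis by (simp add: e_def)
  qed
  have sq_sum: "summable (\<lambda>k. b k * d k)"
    by (rule summable_comparison_test'[OF b_sum, of 0])
      (use b_nonneg d in \<open>auto intro: mult_left_le\<close>)
  have b_tele: "(\<lambda>k. b (Suc k) - b k) sums (0 - b 0)"
    by (rule telescope_sums) (use b_sum in \<open>rule summable_LIMSEQ_zero\<close>)
  have bound_sums: "(\<lambda>k. (b (Suc k) - b k) + 2 * (b k * d k)) sums (0 - b 0 + 2 * (\<Sum>k. b k * d k))"
    by (intro sums_add b_tele sums_mult summable_sums sq_sum)
  have e_sum: "summable (\<lambda>k. \<bar>e k\<bar>)"
    by (rule summable_comparison_test'[OF sums_summable[OF bound_sums], of 0]) (use e_bound in auto)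
  have "norm (of_real (e k) * \<zeta> ^ k) \<le> \<bar>e k\<bar>" for k
    using \<zeta> by (auto simp: norm_mult norm_power intro!: mult_left_le power_le_one)
  then have "norm (\<Sum>k. of_real (e k) * \<zeta> ^ k) \<le> (\<Sum>k. \<bar>e k\<bar>)"
    by (intro norm_suminf_le e_sum)
  also have "\<dots> \<le> (\<Sum>k. (b (Suc k) - b k) + 2 * (b k * d k))"
    by (intro suminf_le e_bound e_sum sums_summable[OF bound_sums])
  also have "\<dots> = - b 0 + 2 * (\<Sum>k. b k * d k)"
    using sums_unique[OF bound_sums] by simp
  finally have 2: "norm (\<Sum>k. of_real (e k) * \<zeta> ^ k) \<le> - b 0 + 2 * (\<Sum>k. b k * d k)" .
  have "norm ((1 - \<zeta>) * B) = norm (of_real (b 0) - \<zeta> * (\<Sum>k. of_real (e k) * \<zeta> ^ k))"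
    using abel[OF b_sum b_nonneg] by (simp add: B_def e_def)
  also have "\<dots> \<le> b 0 + norm \<zeta> * norm (\<Sum>k. of_real (e k) * \<zeta> ^ k)"
    using b_nonneg[of 0] by (metis norm_triangle_ineq4 norm_mult norm_of_real abs_of_nonneg)
  also have "\<dots> \<le> b 0 + norm (\<Sum>k. of_real (e k) * \<zeta> ^ k)"
    using \<zeta> by (simp add: mult_left_le_one_le)
  also have "\<dots> \<le> 2 * (\<Sum>k. b k * d k)" using 2 by simp
  \<comment> \<open>Below \<open>K\<close> the factor \<open>d k\<close> is at most
    \<open>d K\<close> and the \<open>b k\<close> telescope to at most 1; from \<open>K\<close> on
    \<open>d k\<close> is at most 1 and the \<open>b k\<close> telescope to
    \<open>a K\<close>.\<close>
  also have "(\<Sum>k. b k * d k) \<le> d K + a K"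
  proof -
    have a_tele: "(\<lambda>k. a (Suc (k + K)) - a (k + K)) sums (0 - a (0 + K))" for K
      using telescope_sums[of "\<lambda>k. a (k + K)" 0] LIMSEQ_ignore_initial_segment[OF summable_LIMSEQ_zero[OF sum]]
      by simp
    have "(\<Sum>k. b k * d k) = (\<Sum>k<K. b k * d k) + (\<Sum>k. b (k + K) * d (k + K))"
      using suminf_split_initial_segment[OF sq_sum, of K] by simp
    also have "(\<Sum>k<K. b k * d k) \<le> (\<Sum>k<K. b k * d K)"
      by (intro sum_mono mult_left_mono b_nonneg monoD[OF d(1)]) auto
    also have "(\<Sum>k<K. b k * d K) = (a 0 - a K) * d K"
      by (simp add: b_eq flip: sum_distrib_right sum_lessThan_telescope')
    also have "\<dots> \<le> d K"
      using a_nonneg[of K] a_le[of K] d(2)[of K] by (intro mult_left_le_one_le) (auto simp: a0)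
    also have "(\<Sum>k. b (k + K) * d (k + K)) \<le> (\<Sum>k. b (k + K))"
      by (intro suminf_le mult_left_le b_nonneg d) (use sq_sum b_sum in \<open>auto simp: summable_iff_shift[of "\<lambda>k. b k * d k"] summable_iff_shift\<close>)
    also have "(\<Sum>k. b (k + K)) = a K"
      using sums_unique[OF sums_minus[OF a_tele[of K]]] by (simp add: b_eq)
    finally show ?thesis by simp
  qed
  finally have "norm ((1 - \<zeta>) * (- B)) \<le> 2 * (d K + a K)" by simp
  with 1 that show ?thesis by blast
qed

text \<open>The cutoff is \<open>K = 2 * H n\<close>. From index \<open>H n\<close> on each factor
  is at most 1 - x, so \<open>H n\<close> further steps bring the coefficient below
  \<open>(1 - x) ^ H n\<close>, which tends to 0, while \<open>d\<close> at the cutoff is still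
  small. Two quantities below \<epsilon>/4, doubled, stay below \<epsilon>.\<close>

lemma damped_geometric_series_uniform:
  fixes a d :: "nat \<Rightarrow> nat \<Rightarrow> real"
  assumes a0: "\<And>n. a n 0 = 1" and step: "\<And>n k. a n (Suc k) = a n k * (1 - d n k)"
    and d: "\<And>n. mono (d n)" "\<And>n k. 0 \<le> d n k" "\<And>n k. d n k \<le> 1"
    and sum: "\<And>n. 1 \<le> n \<Longrightarrow> summable (a n)"
    and H: "filterlim H at_top sequentially" and x: "0 < x" "\<forall>\<^sub>F n in sequentially. x \<le> d n (H n)"
    and \<epsilon>: "0 < \<epsilon>" "\<forall>\<^sub>F n in sequentially. d n (2 * H n) < \<epsilon> / 4"
  shows "\<forall>\<^sub>F n in sequentially. \<forall>\<zeta>::complex. norm \<zeta> \<le> 1 \<longrightarrow>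
    (\<exists>r. (1 - \<zeta>) * (\<Sum>k. of_real (a n k) * \<zeta> ^ k) = 1 + \<zeta> * r \<and> norm ((1 - \<zeta>) * r) < \<epsilon>)"
proof -
  have a_nonneg: "0 \<le> a n k" for n k
    by (induction k) (auto simp: a0 step d)
  have a_le: "a n k \<le> 1" for n k
  proof (induction k)
    case (Suc k)
    then show ?case
      using mult_left_le[of "1 - d n k" "a n k"] a_nonneg[of n k] d(2)[of n k] by (simp add: step)
  qed (simp add: a0)
  have a_geometric: "a n (h + j) \<le> (1 - d n h) ^ j" for n h j
  proof (induction j)
    case (Suc j)
    have "a n (h + j) * (1 - d n (h + j)) \<le> (1 - d n h) ^ j * (1 - d n h)"
      using Suc d monoD[OF d(1), of h "h + j" n] a_nonneg by (intro mult_mono) auto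
    then show ?case by (simp add: step mult.commute)
  qed (simp add: a_le)
  have "x \<le> 1"
  proof -
    have "\<exists>n. x \<le> d n (H n)" using eventually_happens'[OF _ x(2)] by simp
    then show ?thesis using d(3) order_trans by blast
  qed
  then have "(\<lambda>j. (1 - x) ^ j) \<longlonglongrightarrow> 0"
    using x(1) by (intro LIMSEQ_power_zero) auto
  from filterlim_compose[OF this H] have "\<forall>\<^sub>F n in sequentially. (1 - x) ^ H n < \<epsilon> / 4"
    using \<epsilon>(1) by (intro order_tendstoD) auto
  then show ?thesis
    using x(2) \<epsilon>(2) eventually_ge_at_top[of 1]
  proof eventually_elim
    case (elim n)
    have "a n (2 * H n) \<le> (1 - d n (H n)) ^ H n"
      using a_geometric[of n "H n" "H n"] by (simp add: mult_2)
    also have "\<dots> \<le> (1 - x) ^ H n"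
      using elim d by (intro power_mono) auto
    finally have small: "2 * (d n (2 * H n) + a n (2 * H n)) < \<epsilon>" using elim by simp
    show ?case
    proof (intro allI impI)
      fix \<zeta> :: complex assume \<zeta>: "norm \<zeta> \<le> 1"
      obtain r where "(1 - \<zeta>) * (\<Sum>k. of_real (a n k) * \<zeta> ^ k) = 1 + \<zeta> * r"
        "norm ((1 - \<zeta>) * r) \<le> 2 * (d n (2 * H n) + a n (2 * H n))"
        by (rule damped_geometric_series[of "a n" "d n" \<zeta> "2 * H n"]) (use a0 step d sum elim \<zeta> in auto)
      with small show "\<exists>r. (1 - \<zeta>) * (\<Sum>k. of_real (a n k) * \<zeta> ^ k) = 1 + \<zeta> * r \<and> norm ((1 - \<zeta>) * r) < \<epsilon>"
        by (intro exI[of _ r]) auto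
    qed
  qed
qed

section \<open>Ratios of values of the Gamma function\<close>

lemma Gamma_log_convex:
  fixes x y t :: real
  assumes "0 < x" "0 < y" "0 \<le> t" "t \<le> 1"
  shows "Gamma ((1 - t) * x + t * y) \<le> Gamma x powr (1 - t) * Gamma y powr t"
proof -
  have pos: "0 < (1 - t) * x + t * y"
    using assms by (cases "t = 0") (auto intro: add_nonneg_pos)
  have "ln (Gamma ((1 - t) * x + t * y)) \<le> (1 - t) * ln (Gamma x) + t * ln (Gamma y)"
    using convex_onD[OF log_convex_Gamma_real, of t x y] assms by simp
  then have "Gamma ((1 - t) * x + t * y) \<le> exp ((1 - t) * ln (Gamma x) + t * ln (Gamma y))"
    using Gamma_real_pos[OF pos] by (metis exp_le_cancel_iff exp_ln)
  also have "\<dots> = Gamma x powr (1 - t) * Gamma y powr t"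
    using Gamma_real_pos assms by (simp add: powr_def exp_add less_imp_neq[symmetric])
  finally show ?thesis .
qed

text \<open>Wendel's upper bound: \<open>x + s\<close> lies between \<open>x\<close> and
  \<open>x + 1\<close>, and log-convexity interpolates between \<open>Gamma x\<close> and
  \<open>x * Gamma x\<close>.\<close>

lemma Gamma_ratio_le:
  fixes x s :: real
  assumes "0 < x" "0 \<le> s" "s \<le> 1"
  shows "Gamma (x + s) \<le> x powr s * Gamma x"
proof -
  have G: "Gamma x > 0" using assms by simp
  have "Gamma (x + s) \<le> Gamma x powr (1 - s) * Gamma (x + 1) powr s"
    using Gamma_log_convex[of x "x + 1" s] assms by (simp add: algebra_simps)
  also have "Gamma (x + 1) = x * Gamma x"
    using assms by (intro Gamma_plus1) auto
  also have "Gamma x powr (1 - s) * (x * Gamma x) powr s = x powr s * (Gamma x powr (1 - s) * Gamma x powr s)"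
    using assms G by (simp add: powr_mult)
  also have "Gamma x powr (1 - s) * Gamma x powr s = Gamma x"
    using G by (simp flip: powr_add)
  finally show ?thesis .
qed

text \<open>The upper bound is used again for the remaining step \<open>1 - s\<close> from
  \<open>x + s\<close> up to \<open>x + 1\<close>.\<close>

lemma Gamma_ratio_ge:
  fixes x s :: real
  assumes "0 < x" "0 \<le> s" "s \<le> 1"
  shows "x * (x + s) powr (s - 1) * Gamma x \<le> Gamma (x + s)"
proof -
  have "x * Gamma x = Gamma (x + s + (1 - s))"
    using assms Gamma_plus1[of x] by force
  also have "\<dots> \<le> (x + s) powr (1 - s) * Gamma (x + s)"
    using assms by (intro Gamma_ratio_le) auto
  finally have "x * Gamma x * (x + s) powr (s - 1) \<le> (x + s) powr (1 - s) * Gamma (x + s) * (x + s) powr (s - 1)"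
    by (intro mult_right_mono) auto
  also have "\<dots> = Gamma (x + s)"
    using assms by (simp add: mult_ac flip: powr_add)
  finally show ?thesis by (simp add: mult_ac)
qed

lemma Gamma_shift_asymp:
  fixes s :: real
  assumes "0 \<le> s" "s \<le> 1"
  shows "((\<lambda>x. Gamma (x + s) / (x powr s * Gamma x)) \<longlongrightarrow> 1) at_top"
proof (rule tendsto_sandwich)
  show "((\<lambda>x. x / (x + s) * ((x + s) / x) powr s) \<longlongrightarrow> 1) at_top"
    by real_asymp
  show "((\<lambda>x. 1) \<longlongrightarrow> 1) (at_top :: real filter)" by simp
  show "\<forall>\<^sub>F x in at_top. x / (x + s) * ((x + s) / x) powr s \<le> Gamma (x + s) / (x powr s * Gamma x)"
    using eventually_gt_at_top[of 0]
  proof eventually_elim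
    case (elim x)
    have G: "Gamma x > 0" using elim by simp
    have "x / (x + s) * ((x + s) / x) powr s = x * (x + s) powr (s - 1) * Gamma x / (x powr s * Gamma x)"
      using elim assms less_imp_neq[OF G] by (simp add: powr_divide powr_diff)
    also have "\<dots> \<le> Gamma (x + s) / (x powr s * Gamma x)"
      using elim assms G by (intro divide_right_mono Gamma_ratio_ge) auto
    finally show ?case .
  qed
  show "\<forall>\<^sub>F x in at_top. Gamma (x + s) / (x powr s * Gamma x) \<le> 1"
    using eventually_gt_at_top[of 0]
    by eventually_elim (use assms in \<open>auto simp: divide_le_eq intro!: Gamma_ratio_le\<close>)
qed

text \<open>Both \<open>x + s\<close> and \<open>y\<close> are convex combinations of
  \<open>x\<close> and \<open>y + s\<close>, with exchanged weights. On multiplying the two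
  log-convexity bounds the exponents add up to 1.\<close>

lemma Gamma_ratio_mono:
  fixes x y s :: real
  assumes "0 < x" "x \<le> y" "0 \<le> s"
  shows "Gamma (x + s) / Gamma x \<le> Gamma (y + s) / Gamma y"
proof (cases "s = 0 \<or> x = y")
  case True
  have "Gamma x > 0" "Gamma y > 0" using assms by auto
  then show ?thesis using True by auto
next
  case False
  define t where "t = s / (y + s - x)"
  have t: "0 \<le> t" "t \<le> 1" "t * (y + s - x) = s" using assms False by (auto simp: t_def)
  have pos: "Gamma x > 0" "Gamma y > 0" "Gamma (x + s) > 0" "Gamma (y + s) > 0" using assms by auto
  have "x + s = (1 - t) * x + t * (y + s)" using t(3) by (simp add: algebra_simps)
  then have 1: "Gamma (x + s) \<le> Gamma x powr (1 - t) * Gamma (y + s) powr t"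
    using Gamma_log_convex[of x "y + s" t] assms t by simp
  have "y = (1 - (1 - t)) * x + (1 - t) * (y + s)" using t(3) by (simp add: algebra_simps)
  then have 2: "Gamma y \<le> Gamma x powr t * Gamma (y + s) powr (1 - t)"
    using Gamma_log_convex[of x "y + s" "1 - t"] assms t by simp
  have "Gamma (x + s) * Gamma y \<le> (Gamma x powr (1 - t) * Gamma (y + s) powr t) * (Gamma x powr t * Gamma (y + s) powr (1 - t))"
    using 1 2 pos by (intro mult_mono) auto
  also have "\<dots> = (Gamma x powr (1 - t) * Gamma x powr t) * (Gamma (y + s) powr t * Gamma (y + s) powr (1 - t))"
    by (simp add: mult_ac)
  also have "\<dots> = Gamma x * Gamma (y + s)"
    using pos by (simp flip: powr_add)
  finally show ?thesis using pos by (simp add: field_simps)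
qed

section \<open>Hankel's integral in logarithmic coordinates\<close>

text \<open>With \<open>\<zeta> = exp u\<close>, Hankel's loop around the negative real axis becomes the boundary of a
  half strip; by Cauchy's theorem it may be closed by a vertical segment far to the right.\<close>

definition vseg :: "real \<Rightarrow> real \<Rightarrow> (complex \<Rightarrow> complex) \<Rightarrow> complex" where
  "vseg \<theta> b f = contour_integral (linepath (Complex b (-\<theta>)) (Complex b \<theta>)) f / (2 * of_real pi * \<i>)"

text \<open>A real parametrization, because on these lines the integrand is compared with a real
  integrand of Gamma type.\<close>

definition hseg :: "real \<Rightarrow> real \<Rightarrow> real \<Rightarrow> (complex \<Rightarrow> complex) \<Rightarrow> complex" where
  "hseg a b y f = integral {a..b} (\<lambda>x. f (Complex x y))"

section \<open>Moving vertical segments across rectangles\<close>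

lemma closed_segment_vertical:
  "s \<le> t \<Longrightarrow> closed_segment (Complex b s) (Complex b t) = {u. Re u = b \<and> s \<le> Im u \<and> Im u \<le> t}"
  by (auto simp: closed_segment_same_Re closed_segment_eq_real_ivl)

lemma contour_integral_horizontal:
  assumes "a < b" "f contour_integrable_on linepath (Complex a y) (Complex b y)"
  shows "contour_integral (linepath (Complex a y) (Complex b y)) f = hseg a b y f"
proof -
  let ?l = "linepath (Complex a y) (Complex b y)"
  have l: "?l x = Complex ((b - a) *\<^sub>R x + a) y" for x
    by (simp add: linepath_def complex_eq_iff algebra_simps)
  have ba: "Complex b y - Complex a y = of_real (b - a)"
    by (simp add: complex_eq_iff)
  have "(f has_contour_integral contour_integral ?l f) ?l"
    using assms(2) by (rule has_contour_integral_integral)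
  then have "((\<lambda>x. f (?l x) * of_real (b - a)) has_integral contour_integral ?l f) {0..1}"
    by (simp add: has_contour_integral_linepath ba)
  from has_integral_divide[OF this, of "of_real (b - a)"]
  have "((\<lambda>x. f (Complex ((b - a) *\<^sub>R x + a) y)) has_integral contour_integral ?l f /\<^sub>R (b - a)) {0..1}"
    using assms(1) by (simp add: l scaleR_conv_of_real divide_inverse mult.commute flip: mult.assoc del: of_real_diff)
  then have "((\<lambda>x. f (Complex x y)) has_integral contour_integral ?l f) (cbox a b)"
    using assms(1) by (subst has_integral_affinity_iff[of "b - a" "\<lambda>x. f (Complex x y)" a, symmetric]) auto
  then show ?thesis by (simp add: hseg_def integral_unique)
qed

text \<open>The residue theorem for the rectangle between the two segments. The strip of half-height
  \<eta> is an open convex neighbourhood of the closed rectangle; every enclosed pole has winding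
  number 1.\<close>

lemma vseg_shift:
  assumes "0 < \<theta>" "\<theta> < \<eta>" "a < b" "finite pts"
    and hol: "f holomorphic_on {u. \<bar>Im u\<bar> < \<eta>} - pts"
    and pts: "\<And>p. p \<in> pts \<Longrightarrow> a < Re p \<and> Re p < b \<and> \<bar>Im p\<bar> < \<theta>"
  shows "vseg \<theta> b f = vseg \<theta> a f + (\<Sum>p\<in>pts. residue f p)
    + (hseg a b \<theta> f - hseg a b (-\<theta>) f) / (2 * of_real pi * \<i>)"
proof -
  define S where "S = {u. \<bar>Im u\<bar> < \<eta>}"
  define A B where "A = Complex a (-\<theta>)" and "B = Complex b \<theta>"
  let ?A' = "Complex b (-\<theta>)" and ?B' = "Complex a \<theta>"
  have S_eq: "S = {u. -\<eta> < Im u} \<inter> {u. Im u < \<eta>}" by (auto simp: S_def)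
  have S: "open S" "convex S"
    unfolding S_eq by (auto intro!: open_Int convex_Int open_halfspace_Im_gt open_halfspace_Im_lt
        convex_halfspace_Im_gt convex_halfspace_Im_lt)
  have image: "path_image (rectpath A B) \<subseteq> S - pts"
  proof
    fix u assume "u \<in> path_image (rectpath A B)"
    then have u: "u \<in> cbox A B" "u \<notin> box A B"
      using assms by (auto simp: path_image_rectpath_cbox_minus_box A_def B_def)
    have "u \<notin> pts"
      using u(2) pts[of u] by (auto simp: in_box_complex_iff A_def B_def)
    with u(1) show "u \<in> S - pts"
      using assms by (auto simp: in_cbox_complex_iff A_def B_def S_def)
  qed
  have "contour_integral (rectpath A B) f
      = 2 * pi * \<i> * (\<Sum>p\<in>pts. winding_number (rectpath A B) p * residue f p)"
  proof (rule Residue_theorem)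
    show "\<forall>z. z \<notin> S \<longrightarrow> winding_number (rectpath A B) z = 0"
    proof (intro allI impI winding_number_rectpath_outside)
      fix z assume "z \<notin> S"
      then show "z \<notin> cbox A B"
        using assms by (auto simp: in_cbox_complex_iff A_def B_def S_def)
    qed (use assms in \<open>auto simp: A_def B_def\<close>)
  qed (use S image assms in \<open>auto simp: S_def convex_connected\<close>)
  also have "(\<Sum>p\<in>pts. winding_number (rectpath A B) p * residue f p) = (\<Sum>p\<in>pts. residue f p)"
    by (intro sum.cong refl, subst winding_number_rectpath)
      (use pts in \<open>auto simp: in_box_complex_iff A_def B_def\<close>, fastforce+)
  finally have 1: "contour_integral (rectpath A B) f = 2 * pi * \<i> * (\<Sum>p\<in>pts. residue f p)" .
  have cont: "continuous_on (path_image (rectpath A B)) f"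
    using holomorphic_on_imp_continuous_on[OF hol] image
    by (auto simp: S_def intro: continuous_on_subset)
  have segs: "closed_segment A ?A' \<subseteq> path_image (rectpath A B)"
    "closed_segment ?A' B \<subseteq> path_image (rectpath A B)"
    "closed_segment B ?B' \<subseteq> path_image (rectpath A B)"
    "closed_segment ?B' A \<subseteq> path_image (rectpath A B)"
    by (auto simp: rectpath_def Let_def path_image_join A_def B_def)
  have int: "f contour_integrable_on linepath A ?A'" "f contour_integrable_on linepath ?A' B"
    "f contour_integrable_on linepath B ?B'" "f contour_integrable_on linepath ?B' A"
    by (intro contour_integrable_continuous_linepath continuous_on_subset[OF cont] segs)+
  have "contour_integral (rectpath A B) f = contour_integral (linepath A ?A') f
     + (contour_integral (linepath ?A' B) f + (contour_integral (linepath B ?B') f + contour_integral (linepath ?B' A) f))"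
    using int by (simp add: rectpath_def Let_def A_def B_def contour_integrable_joinI)
  also have "contour_integral (linepath B ?B') f = - contour_integral (linepath ?B' B) f"
    by (metis contour_integral_reversepath reversepath_linepath valid_path_linepath)
  also have "contour_integral (linepath ?B' A) f = - contour_integral (linepath A ?B') f"
    by (metis contour_integral_reversepath reversepath_linepath valid_path_linepath)
  also have "contour_integral (linepath A ?A') f = hseg a b (-\<theta>) f"
    using contour_integral_horizontal[OF \<open>a < b\<close>, of f "-\<theta>"] int(1) by (simp add: A_def)
  also have "contour_integral (linepath ?B' B) f = hseg a b \<theta> f"
    unfolding B_def
  proof (rule contour_integral_horizontal[OF \<open>a < b\<close>])
    show "f contour_integrable_on linepath ?B' (Complex b \<theta>)"
      by (intro contour_integrable_continuous_linepath continuous_on_subset[OF cont])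
        (use segs(3) in \<open>auto simp: B_def closed_segment_commute\<close>)
  qed
  finally have "2 * pi * \<i> * (\<Sum>p\<in>pts. residue f p) = 2 * pi * \<i> * vseg \<theta> b f - 2 * pi * \<i> * vseg \<theta> a f
      + hseg a b (-\<theta>) f - hseg a b \<theta> f"
    unfolding 1 by (simp add: vseg_def A_def B_def)
  then show ?thesis by (simp add: field_simps)
qed

text \<open>The length 2 \<theta> of the segment is at most 2 \<pi>, which the normalization of
  \<open>vseg\<close> divides out.\<close>

lemma vseg_bound:
  assumes "0 < \<theta>" "\<theta> \<le> pi" "continuous_on {u. Re u = b \<and> \<bar>Im u\<bar> \<le> \<theta>} f" "0 \<le> B"
    and bound: "\<And>u. Re u = b \<Longrightarrow> \<bar>Im u\<bar> \<le> \<theta> \<Longrightarrow> norm (f u) \<le> B"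
  shows "norm (vseg \<theta> b f) \<le> B"
proof -
  have seg: "closed_segment (Complex b (-\<theta>)) (Complex b \<theta>) = {u. Re u = b \<and> \<bar>Im u\<bar> \<le> \<theta>}"
    using assms by (auto simp: closed_segment_vertical)
  have "norm (contour_integral (linepath (Complex b (-\<theta>)) (Complex b \<theta>)) f)
     \<le> B * norm (Complex b \<theta> - Complex b (-\<theta>))"
    by (intro contour_integral_bound_linepath contour_integrable_continuous_linepath)
      (use assms seg in auto)
  also have "Complex b \<theta> - Complex b (-\<theta>) = 2 * \<theta> * \<i>" by (simp add: complex_eq_iff)
  also have "B * norm (2 * \<theta> * \<i>) \<le> B * (2 * pi)"
    using assms by (intro mult_left_mono) (auto simp: norm_mult)
  finally show ?thesis by (simp add: vseg_def norm_divide norm_mult field_simps)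
qed

section \<open>Truncated Gamma integrals in a logarithmic variable\<close>

text \<open>Substitution \<open>t = c * exp x\<close>. Integrands of this shape arise on the
  horizontal sides, where \<open>exp u\<close> has real part \<open>- c * exp x\<close> if
  \<open>cos (Im u) = - c\<close>.\<close>

lemma Gamma_exp_integral:
  fixes \<gamma> c a b :: real
  assumes "0 < \<gamma>" "0 < c" "a \<le> b"
  shows "integral {a..b} (\<lambda>x. exp (\<gamma> * x - c * exp x))
     = c powr (-\<gamma>) * integral {c * exp a..c * exp b} (\<lambda>t. t powr (\<gamma> - 1) / exp t)"
    "(\<lambda>x. exp (\<gamma> * x - c * exp x)) integrable_on {a..b}"
proof -
  have "((\<lambda>x. (c * exp x) *\<^sub>R ((c * exp x) powr (\<gamma> - 1) / exp (c * exp x))) has_integral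
     integral {c * exp a..c * exp b} (\<lambda>t. t powr (\<gamma> - 1) / exp t)) {a..b}"
    by (rule has_integral_substitution[where c = "c * exp a" and d = "c * exp b"])
      (use assms in \<open>auto intro!: continuous_intros derivative_eq_intros simp: mult_le_0_iff\<close>)
  moreover have "(c * exp x) *\<^sub>R ((c * exp x) powr (\<gamma> - 1) / exp (c * exp x)) = c powr \<gamma> * exp (\<gamma> * x - c * exp x)" for x
    using assms by (simp add: powr_mult powr_diff exp_diff exp_powr_real powr_powr mult.commute field_simps)
  ultimately have "((\<lambda>x. c powr \<gamma> * exp (\<gamma> * x - c * exp x)) has_integral
     integral {c * exp a..c * exp b} (\<lambda>t. t powr (\<gamma> - 1) / exp t)) {a..b}" by simp
  from has_integral_mult_right[OF this, of "c powr (-\<gamma>)"]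
  have *: "((\<lambda>x. exp (\<gamma> * x - c * exp x)) has_integral
     c powr (-\<gamma>) * integral {c * exp a..c * exp b} (\<lambda>t. t powr (\<gamma> - 1) / exp t)) {a..b}"
    using assms by (simp add: mult.assoc[symmetric] powr_add[symmetric])
  show "integral {a..b} (\<lambda>x. exp (\<gamma> * x - c * exp x))
     = c powr (-\<gamma>) * integral {c * exp a..c * exp b} (\<lambda>t. t powr (\<gamma> - 1) / exp t)"
    using * by (rule integral_unique)
  show "(\<lambda>x. exp (\<gamma> * x - c * exp x)) integrable_on {a..b}"
    using * by blast
qed

lemma Gamma_exp_integral_le:
  fixes \<gamma> c a b :: real
  assumes "0 < \<gamma>" "0 < c" "a \<le> b"
  shows "integral {a..b} (\<lambda>x. exp (\<gamma> * x - c * exp x)) \<le> c powr (-\<gamma>) * Gamma \<gamma>"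
proof -
  have "integral {c * exp a..c * exp b} (\<lambda>t. t powr (\<gamma> - 1) / exp t) \<le> integral {0..} (\<lambda>t. t powr (\<gamma> - 1) / exp t)"
    using assms Gamma_integral_real[of \<gamma>]
    by (intro integral_subset_le)
      (auto intro!: integrable_continuous_real continuous_intros simp: mult_le_0_iff intro: order_trans[rotated])
  also have "\<dots> = Gamma \<gamma>" using Gamma_integral_real[of \<gamma>] assms by (intro integral_unique) auto
  finally show ?thesis using assms by (simp add: Gamma_exp_integral mult_left_mono)
qed

lemma Gamma_exp_integral_tendsto:
  fixes \<gamma> :: real
  assumes "0 < \<gamma>"
  shows "(\<lambda>m. integral {-real m..real m} (\<lambda>x. exp (\<gamma> * x - exp x))) \<longlonglongrightarrow> Gamma \<gamma>"
proof -
  define g where "g = (\<lambda>t::real. t powr (\<gamma> - 1) / exp t)"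
  define A where "A = (\<lambda>m::nat. {exp (- real m)..exp (real m)})"
  have g: "(g has_integral Gamma \<gamma>) {0..}"
    unfolding g_def using assms by (rule Gamma_integral_real)
  have A: "A m \<subseteq> {0..}" for m by (auto simp: A_def intro: order_trans[rotated])
  define f where "f = (\<lambda>m t. if t \<in> A m then g t else 0)"
  have g_nonneg: "0 \<le> g t" for t by (simp add: g_def)
  have g_int: "g integrable_on A m" for m
    unfolding A_def g_def by (intro integrable_continuous_real continuous_intros) (auto simp: not_le intro: less_le_trans)
  have f_int: "f m integrable_on {0..}" and f_eq: "integral {0..} (f m) = integral (A m) g" for m
  proof -
    show "f m integrable_on {0..}" "integral {0..} (f m) = integral (A m) g"
      using A[of m] g_int[of m] unfolding f_def by (simp_all add: integrable_restrict_Int integral_restrict_Int Int_absorb1 Int_absorb2)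
  qed
  have "g integrable_on {0..} \<and> (\<lambda>m. integral {0..} (f m)) \<longlonglongrightarrow> integral {0..} g"
  proof (rule monotone_convergence_increasing)
    fix t :: real assume t: "t \<in> {0..}"
    show "(\<lambda>m. f m t) \<longlonglongrightarrow> g t"
    \<comment> \<open>At t = 0 no truncation contains the point, so \<open>f m 0 = 0\<close>; this
      agrees with \<open>g 0\<close>, because \<open>0 powr _\<close> is 0.\<close>
    proof (cases "t = 0")
      case False
      obtain M :: nat where M: "\<bar>ln t\<bar> \<le> real M" using real_arch_simple by blast
      have "f m t = g t" if "m \<ge> M" for m
      proof -
        have "- real m \<le> ln t" "ln t \<le> real m" using M that by auto
        then have "exp (- real m) \<le> t" "t \<le> exp (real m)"
          using False t by (auto simp: ln_ge_iff) (metis exp_le_cancel_iff exp_ln less_eq_real_def)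
        then show ?thesis using False t by (simp add: f_def A_def)
      qed
      then show ?thesis
        by (intro tendsto_eventually) (auto simp: eventually_sequentially)
    qed (auto simp: f_def g_def cong: if_cong)
  next
    show "f m t \<le> f (Suc m) t" if "t \<in> {0..}" for m t
    proof -
      have "A m \<subseteq> A (Suc m)" by (auto simp: A_def intro: order_trans)
      then show ?thesis using g_nonneg[of t] by (auto simp: f_def)
    qed
  next
    have "integral {0..} (f m) \<le> Gamma \<gamma>" for m
      using integral_subset_le[OF A[of m] g_int[of m], of] g g_nonneg
      unfolding f_eq by (metis has_integral_integrable integral_unique)
    moreover have "0 \<le> integral {0..} (f m)" for m
      by (intro integral_nonneg f_int) (auto simp: f_def g_nonneg)
    ultimately show "bounded (range (\<lambda>m. integral {0..} (f m)))"
      by (intro boundedI[of _ "Gamma \<gamma>"]) auto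
  qed (rule f_int)
  then have "(\<lambda>m. integral (A m) g) \<longlonglongrightarrow> Gamma \<gamma>"
    using g by (simp add: f_eq integral_unique)
  moreover have "integral {-real m..real m} (\<lambda>x. exp (\<gamma> * x - exp x)) = integral (A m) g" for m
    using Gamma_exp_integral(1)[OF assms, of 1 "- real m" "real m"] by (simp add: A_def g_def)
  ultimately show ?thesis by simp
qed

section \<open>Hankel's formula for the reciprocal Gamma function\<close>

lemma norm_exp_exp: "norm (exp (exp u + of_real \<beta> * u)) = exp (exp (Re u) * cos (Im u) + \<beta> * Re u)"
  by (simp add: Re_exp)

text \<open>Integration by parts: the derivative of the integrand for \<beta> is the integrand for
  \<beta> + 1 plus \<beta> times itself. At the end points \<open>Im u\<close> is \<pi> or -\<pi>,
  so \<open>exp u\<close> is negative real and the boundary terms decay doubly exponentially. The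
  relation is the functional equation of the reciprocal Gamma function.\<close>

lemma vseg_hankel_recurrence:
  fixes \<beta> :: real
  shows "(\<lambda>m. vseg pi (real m) (\<lambda>u. exp (exp u + of_real (\<beta> + 1) * u))
      + of_real \<beta> * vseg pi (real m) (\<lambda>u. exp (exp u + of_real \<beta> * u))) \<longlonglongrightarrow> 0"
proof -
  define F where "F = (\<lambda>u::complex. exp (exp u + of_real \<beta> * u))"
  define F1 where "F1 = (\<lambda>u::complex. exp (exp u + of_real (\<beta> + 1) * u))"
  have deriv: "(F has_field_derivative F1 u + of_real \<beta> * F u) (at u within S)" for u S
    unfolding F_def F1_def by (auto intro!: derivative_eq_intros simp: exp_add algebra_simps)
  have eq: "vseg pi b F1 + of_real \<beta> * vseg pi b F = (F (Complex b pi) - F (Complex b (-pi))) / (2 * of_real pi * \<i>)" for b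
  proof -
    let ?l = "linepath (Complex b (-pi)) (Complex b pi)"
    have int: "F contour_integrable_on ?l" "F1 contour_integrable_on ?l"
      unfolding F_def F1_def by (intro contour_integrable_continuous_linepath continuous_intros)+
    have "((\<lambda>u. F1 u + of_real \<beta> * F u) has_contour_integral (F (pathfinish ?l) - F (pathstart ?l))) ?l"
      by (rule contour_integral_primitive[OF deriv, of _ UNIV]) auto
    moreover have "((\<lambda>u. F1 u + of_real \<beta> * F u) has_contour_integral
        (contour_integral ?l F1 + of_real \<beta> * contour_integral ?l F)) ?l"
      by (intro has_contour_integral_add has_contour_integral_lmul has_contour_integral_integral int)
    ultimately have "contour_integral ?l F1 + of_real \<beta> * contour_integral ?l F = F (Complex b pi) - F (Complex b (-pi))"
      by (auto dest: has_contour_integral_unique)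
    then show ?thesis by (simp add: vseg_def divide_simps)
  qed
  have "(\<lambda>m. (F (Complex (real m) pi) - F (Complex (real m) (-pi))) / (2 * of_real pi * \<i>)) \<longlonglongrightarrow> 0"
  proof (rule Lim_null_comparison)
    have "norm (F (Complex b pi) - F (Complex b (-pi))) \<le> 2 * exp (\<beta> * b - exp b)" for b
      by (rule order_trans[OF norm_triangle_ineq4]) (simp add: F_def norm_exp_exp del: norm_exp_eq_Re)
    from divide_right_mono[OF this, of "2 * pi"]
    show "\<forall>\<^sub>F m in sequentially. norm ((F (Complex (real m) pi) - F (Complex (real m) (-pi))) / (2 * of_real pi * \<i>))
      \<le> 2 * exp (\<beta> * real m - exp (real m)) / (2 * pi)"
      by (intro always_eventually allI) (simp add: norm_divide norm_mult)
    show "(\<lambda>m. 2 * exp (\<beta> * real m - exp (real m)) / (2 * pi)) \<longlonglongrightarrow> 0"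
      by real_asymp
  qed
  then show ?thesis unfolding F_def[symmetric] F1_def[symmetric] eq .
qed

text \<open>A positive \<beta> makes the integrand vanish at the far left. For \<beta> <= 0 it does
  not, which is why Hankel's formula is first proved for positive \<beta> and then carried downwards
  by the recurrence.\<close>

lemma vseg_hankel_left:
  assumes "0 < \<beta>" "0 < \<theta>" "\<theta> \<le> pi"
  shows "(\<lambda>m. vseg \<theta> (- real m) (\<lambda>u. exp (exp u + of_real \<beta> * u))) \<longlonglongrightarrow> 0"
proof (rule Lim_null_comparison)
  have "norm (vseg \<theta> b (\<lambda>u. exp (exp u + of_real \<beta> * u))) \<le> exp (exp b + \<beta> * b)" for b
  proof (rule vseg_bound)
    fix u :: complex assume "Re u = b"
    then show "norm (exp (exp u + of_real \<beta> * u)) \<le> exp (exp b + \<beta> * b)"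
      using mult_left_mono[OF cos_le_one, of "exp b" "Im u"] by (simp add: norm_exp_exp del: norm_exp_eq_Re)
  qed (use assms in \<open>auto intro!: continuous_intros\<close>)
  then show "\<forall>\<^sub>F m in sequentially. norm (vseg \<theta> (- real m) (\<lambda>u. exp (exp u + of_real \<beta> * u)))
      \<le> exp (exp (- real m) + \<beta> * (- real m))"
    by (intro always_eventually allI)
  show "(\<lambda>m. exp (exp (- real m) + \<beta> * (- real m))) \<longlonglongrightarrow> 0"
    using assms by real_asymp
qed

lemma vseg_shift_symmetric:
  assumes "0 < m" "0 < \<theta>" "\<theta> < \<eta>" "f holomorphic_on {u. \<bar>Im u\<bar> < \<eta>}"
  shows "vseg \<theta> (real m) f = vseg \<theta> (- real m) f
    + (hseg (- real m) (real m) \<theta> f - hseg (- real m) (real m) (-\<theta>) f) / (2 * of_real pi * \<i>)"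
  using vseg_shift[of \<theta> \<eta> "- real m" "real m" "{}" f] assms by simp

text \<open>On the lines at height \<pi> and -\<pi> the integrand is a real Gamma integrand times a
  constant phase. The difference of the two phases gives
  \<open>sin (pi * \<beta>) / pi * Gamma \<beta>\<close>, and the reflection formula turns this into
  \<open>rGamma (1 - \<beta>)\<close>.\<close>

lemma vseg_hankel_pos:
  assumes "0 < \<beta>"
  shows "(\<lambda>m. vseg pi (real m) (\<lambda>u. exp (exp u + of_real \<beta> * u))) \<longlonglongrightarrow> of_real (rGamma (1 - \<beta>))"
proof -
  define F where "F = (\<lambda>u::complex. exp (exp u + of_real \<beta> * u))"
  define I where "I = (\<lambda>m. integral {-real m..real m} (\<lambda>x. exp (\<beta> * x - exp x)))"
  have h: "hseg (- real m) (real m) y F = exp (of_real (\<beta> * y) * \<i>) * of_real (I m)" if "cos y = -1" "sin y = 0" for m y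
  proof -
    have "((\<lambda>x. exp (\<beta> * x - exp x)) has_integral I m) {-real m..real m}"
      using Gamma_exp_integral(2)[OF assms, of 1 "- real m" "real m"] unfolding I_def by (intro integrable_integral) simp
    then have "((\<lambda>x. exp (of_real (\<beta> * y) * \<i>) * of_real (exp (\<beta> * x - exp x))) has_integral exp (of_real (\<beta> * y) * \<i>) * complex_of_real (I m)) {-real m..real m}"
      by (intro has_integral_mult_right has_integral_of_real)
    moreover have "exp (of_real (\<beta> * y) * \<i>) * of_real (exp (\<beta> * x - exp x)) = F (Complex x y)" for x
    proof -
      have "exp (Complex x y) = - of_real (exp x)"
        using that by (simp add: exp_eq_polar complex_eq_iff)
      then show ?thesis
        by (simp add: F_def exp_of_real[symmetric] exp_add[symmetric] Complex_eq algebra_simps)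
    qed
    ultimately show ?thesis unfolding hseg_def by (simp add: integral_unique)
  qed
  have "\<forall>\<^sub>F m in sequentially. vseg pi (- real m) F + of_real (sin (pi * \<beta>) / pi) * of_real (I m) = vseg pi (real m) F"
    using eventually_gt_at_top[of "0::nat"]
  proof eventually_elim
    case (elim m)
    have "vseg pi (real m) F = vseg pi (- real m) F
      + (hseg (- real m) (real m) pi F - hseg (- real m) (real m) (-pi) F) / (2 * of_real pi * \<i>)"
      \<comment> \<open>The integrand is entire, so any strip of half-height above \<pi> serves; 4
        is such a number.\<close>
      by (rule vseg_shift_symmetric[OF elim, of _ 4]) (auto simp: F_def pi_less_4 intro!: holomorphic_intros)
    also have "hseg (- real m) (real m) pi F - hseg (- real m) (real m) (-pi) F
       = (cis (pi * \<beta>) - cis (- (pi * \<beta>))) * of_real (I m)"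
      by (simp add: h cis_conv_exp algebra_simps)
    also have "cis (pi * \<beta>) - cis (- (pi * \<beta>)) = 2 * \<i> * of_real (sin (pi * \<beta>))"
      by (simp add: complex_eq_iff)
    finally show ?case by simp
  qed
  moreover have "(\<lambda>m. vseg pi (- real m) F + of_real (sin (pi * \<beta>) / pi) * of_real (I m))
      \<longlonglongrightarrow> 0 + of_real (sin (pi * \<beta>) / pi) * of_real (Gamma \<beta>)"
    unfolding F_def I_def by (intro tendsto_intros vseg_hankel_left Gamma_exp_integral_tendsto assms) auto
  moreover have "sin (pi * \<beta>) / pi * Gamma \<beta> = rGamma (1 - \<beta>)"
  proof -
    have "complex_of_real (rGamma \<beta> * rGamma (1 - \<beta>)) = of_real (sin (pi * \<beta>) / pi)"
      using rGamma_reflection_complex[of "of_real \<beta>"]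
      unfolding of_real_mult of_real_divide rGamma_complex_of_real[symmetric] sin_of_real[symmetric] by simp
    then have "rGamma \<beta> * rGamma (1 - \<beta>) = sin (pi * \<beta>) / pi"
      by (simp only: of_real_eq_iff)
    moreover have "Gamma \<beta> * rGamma \<beta> = 1"
      using Gamma_real_pos[OF assms] by (simp add: rGamma_inverse_Gamma)
    ultimately show ?thesis by (metis mult.assoc mult.commute mult.left_neutral)
  qed
  ultimately show ?thesis
    unfolding F_def by (simp add: Lim_transform_eventually flip: of_real_mult of_real_divide)
qed

text \<open>The recurrence cannot reach \<beta> = 0, where it would divide by 0. Here the integrand
  has period 2 \<pi> i, so the horizontal sides cancel, and at the far left it tends to 1.\<close>

lemma vseg_hankel_zero:
  "(\<lambda>m. vseg pi (real m) (\<lambda>u. exp (exp u + of_real 0 * u))) \<longlonglongrightarrow> 1"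
proof -
  define F where "F = (\<lambda>u::complex. exp (exp u))"
  have one: "vseg pi b (\<lambda>_. 1) = 1" for b
  proof -
    have "Complex b pi - Complex b (- pi) = 2 * of_real pi * \<i>" by (simp add: complex_eq_iff)
    then show ?thesis by (simp add: vseg_def)
  qed
  have eq: "vseg pi b F - 1 = vseg pi b (\<lambda>u. F u - 1)" for b
  proof -
    let ?l = "linepath (Complex b (-pi)) (Complex b pi)"
    have "contour_integral ?l (\<lambda>u. F u - 1) = contour_integral ?l F - contour_integral ?l (\<lambda>_. 1)"
      unfolding F_def by (intro contour_integral_diff contour_integrable_continuous_linepath continuous_intros)
    then show ?thesis
      using one[of b] by (simp add: vseg_def diff_divide_distrib)
  qed
  have "(\<lambda>m. vseg pi (- real m) F - 1) \<longlonglongrightarrow> 0"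
  proof (rule Lim_null_comparison)
    have "norm (vseg pi b F - 1) \<le> exp (exp b) * exp b" for b
      unfolding eq
    proof (rule vseg_bound)
      fix u :: complex assume u: "Re u = b"
      have "norm (F u - 1) \<le> exp \<bar>Re (exp u)\<bar> * norm (exp u)"
        using Taylor_exp[of "exp u" 0] by (simp add: F_def)
      also have "\<dots> \<le> exp (exp b) * exp b"
        using u abs_Re_le_cmod[of "exp u"] by simp
      finally show "norm (F u - 1) \<le> exp (exp b) * exp b" .
    qed (auto simp: F_def intro!: continuous_intros)
    then show "\<forall>\<^sub>F m in sequentially. norm (vseg pi (- real m) F - 1) \<le> exp (exp (- real m)) * exp (- real m)"
      by (intro always_eventually allI)
    show "(\<lambda>m. exp (exp (- real m)) * exp (- real m)) \<longlonglongrightarrow> 0" by real_asymp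
  qed
  then have "(\<lambda>m. vseg pi (- real m) F) \<longlonglongrightarrow> 1" by (simp add: LIM_zero_iff)
  moreover have "\<forall>\<^sub>F m in sequentially. vseg pi (- real m) F = vseg pi (real m) F"
    using eventually_gt_at_top[of "0::nat"]
  proof eventually_elim
    case (elim m)
    have "exp (Complex x pi) = exp (Complex x (-pi))" for x
      by (simp add: exp_eq_polar complex_eq_iff)
    then show ?case
      using vseg_shift_symmetric[OF elim, of pi 4 F]
      by (simp add: F_def hseg_def pi_less_4 holomorphic_intros)
  qed
  ultimately show ?thesis
    unfolding F_def by (simp add: Lim_transform_eventually)
qed

text \<open>Induction on n extends the range of validity to \<beta> > -n, one unit at a time. The
  Mittag-Leffler series needs the values \<open>\<beta> = - k / \<rho>\<close>, which are unbounded
  below.\<close>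

lemma vseg_hankel:
  fixes \<beta> :: real
  shows "(\<lambda>m. vseg pi (real m) (\<lambda>u. exp (exp u + of_real \<beta> * u))) \<longlonglongrightarrow> of_real (rGamma (1 - \<beta>))"
proof -
  have "\<forall>\<beta>. - real n < \<beta> \<longrightarrow>
    (\<lambda>m. vseg pi (real m) (\<lambda>u. exp (exp u + of_real \<beta> * u))) \<longlonglongrightarrow> of_real (rGamma (1 - \<beta>))" for n
  proof (induction n)
    case 0
    then show ?case using vseg_hankel_pos by auto
  next
    case (Suc n)
    show ?case
    proof (intro allI impI)
      fix \<beta> :: real assume \<beta>: "- real (Suc n) < \<beta>"
      define V where "V = (\<lambda>\<beta> m. vseg pi (real m) (\<lambda>u. exp (exp u + complex_of_real \<beta> * u)))"
      have "V \<beta> \<longlonglongrightarrow> of_real (rGamma (1 - \<beta>))"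
      proof (cases "\<beta> = 0")
        case True
        then show ?thesis using vseg_hankel_zero by (simp add: V_def)
      next
        case False
        have "(\<lambda>m. V (\<beta> + 1) m + of_real \<beta> * V \<beta> m) \<longlonglongrightarrow> 0"
          unfolding V_def by (rule vseg_hankel_recurrence)
        moreover have "V (\<beta> + 1) \<longlonglongrightarrow> of_real (rGamma (1 - (\<beta> + 1)))"
          unfolding V_def by (rule Suc.IH[rule_format]) (use \<beta> in simp)
        ultimately have "(\<lambda>m. ((V (\<beta> + 1) m + of_real \<beta> * V \<beta> m) - V (\<beta> + 1) m) / of_real \<beta>)
            \<longlonglongrightarrow> (0 - of_real (rGamma (1 - (\<beta> + 1)))) / of_real \<beta>"
          using False by (intro tendsto_intros) auto
        moreover have "rGamma (1 - (\<beta> + 1)) = - \<beta> * rGamma (1 - \<beta>)"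
          using rGamma_plus1[of "- \<beta>"] by (simp add: add.commute)
        ultimately show ?thesis using False by simp
      qed
      then show "(\<lambda>m. vseg pi (real m) (\<lambda>u. exp (exp u + of_real \<beta> * u))) \<longlonglongrightarrow> of_real (rGamma (1 - \<beta>))"
        by (simp add: V_def)
    qed
  qed
  moreover obtain n :: nat where "- \<beta> < real n" using reals_Archimedean2 by blast
  ultimately show ?thesis by (metis minus_less_iff)
qed

text \<open>The pieces cut off between the heights \<theta> and \<pi> lie where
  \<open>cos (Im u)\<close> is at most \<open>cos \<theta> < 0\<close>, hence are doubly
  exponentially small as the segment moves right.\<close>

lemma vseg_hankel_angle:
  fixes \<beta> :: real
  assumes \<theta>: "pi / 2 < \<theta>" "\<theta> \<le> pi"
  shows "(\<lambda>m. vseg \<theta> (real m) (\<lambda>u. exp (exp u + of_real \<beta> * u))) \<longlonglongrightarrow> of_real (rGamma (1 - \<beta>))"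
proof -
  define F where "F = (\<lambda>u::complex. exp (exp u + of_real \<beta> * u))"
  have cos_le: "cos y \<le> cos \<theta>" if "\<theta> \<le> \<bar>y\<bar>" "\<bar>y\<bar> \<le> pi" for y
    using cos_monotone_0_pi_le[of \<theta> "\<bar>y\<bar>"] that \<theta> by simp
  have "norm (vseg \<theta> b F - vseg pi b F) \<le> exp (exp b * cos \<theta> + \<beta> * b)" for b
  proof -
    let ?I = "\<lambda>s t. contour_integral (linepath (Complex b s) (Complex b t)) F"
    have cont: "continuous_on A F" for A unfolding F_def by (intro continuous_intros)
    have "?I (-pi) pi = ?I (-pi) (-\<theta>) + ?I (-\<theta>) pi"
      using \<theta> by (intro contour_integral_split_linepath cont) (auto simp: closed_segment_vertical)
    also have "?I (-\<theta>) pi = ?I (-\<theta>) \<theta> + ?I \<theta> pi"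
      using \<theta> by (intro contour_integral_split_linepath cont) (auto simp: closed_segment_vertical)
    finally have "?I (-\<theta>) \<theta> - ?I (-pi) pi = - (?I (-pi) (-\<theta>) + ?I \<theta> pi)"
      by simp
    then have "norm (?I (-\<theta>) \<theta> - ?I (-pi) pi) = norm (?I (-pi) (-\<theta>) + ?I \<theta> pi)"
      by (simp only: norm_minus_cancel)
    moreover have bound: "norm (?I s t) \<le> exp (exp b * cos \<theta> + \<beta> * b) * norm (Complex b t - Complex b s)"
      if "s \<le> t" "\<And>y. s \<le> y \<Longrightarrow> y \<le> t \<Longrightarrow> \<theta> \<le> \<bar>y\<bar> \<and> \<bar>y\<bar> \<le> pi" for s t
      by (intro contour_integral_bound_linepath contour_integrable_continuous_linepath cont)
        (use that in \<open>auto simp: closed_segment_vertical F_def norm_exp_exp cos_le simp del: norm_exp_eq_Re\<close>)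
    have c: "Complex b t - Complex b s = of_real (t - s) * \<i>" for s t by (simp add: complex_eq_iff)
    have "norm (?I (-pi) (-\<theta>)) \<le> exp (exp b * cos \<theta> + \<beta> * b) * (pi - \<theta>)"
      "norm (?I \<theta> pi) \<le> exp (exp b * cos \<theta> + \<beta> * b) * (pi - \<theta>)"
      using bound[of "-pi" "-\<theta>"] bound[of \<theta> pi] \<theta> unfolding c by (auto simp: norm_mult simp del: of_real_diff)
    ultimately have "norm (?I (-\<theta>) \<theta> - ?I (-pi) pi) \<le> exp (exp b * cos \<theta> + \<beta> * b) * (2 * (pi - \<theta>))"
      using norm_triangle_ineq[of "?I (-pi) (-\<theta>)" "?I \<theta> pi"] by (simp add: algebra_simps)
    also have "\<dots> \<le> exp (exp b * cos \<theta> + \<beta> * b) * (2 * pi)"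
      using \<theta> pi_gt_zero by (intro mult_left_mono) (auto intro: order_trans[of _ 0])
    finally show ?thesis
      unfolding vseg_def diff_divide_distrib[symmetric] norm_divide by (simp add: norm_mult field_simps)
  qed
  then have "\<forall>\<^sub>F m in sequentially. norm (vseg \<theta> (real m) F - vseg pi (real m) F) \<le> exp (exp (real m) * cos \<theta> + \<beta> * real m)"
    by (intro always_eventually allI)
  moreover have "cos \<theta> < 0" using \<theta> cos_monotone_0_pi[of "pi/2" \<theta>] by simp
  then have "(\<lambda>m. exp (exp (real m) * cos \<theta> + \<beta> * real m)) \<longlonglongrightarrow> 0" by real_asymp
  ultimately have "(\<lambda>m. vseg \<theta> (real m) F - vseg pi (real m) F) \<longlonglongrightarrow> 0"
    by (rule Lim_null_comparison)
  from tendsto_add[OF this vseg_hankel[of \<beta>]] show ?thesis by (simp add: F_def)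
qed

section \<open>Asymptotics of the Mittag-Leffler function\<close>

lemma vseg_add:
  assumes "continuous_on {u. Re u = b \<and> \<bar>Im u\<bar> \<le> \<theta>} f" "continuous_on {u. Re u = b \<and> \<bar>Im u\<bar> \<le> \<theta>} g" "0 \<le> \<theta>"
  shows "vseg \<theta> b (\<lambda>u. f u + g u) = vseg \<theta> b f + vseg \<theta> b g"
proof -
  have "closed_segment (Complex b (-\<theta>)) (Complex b \<theta>) = {u. Re u = b \<and> \<bar>Im u\<bar> \<le> \<theta>}"
    using assms(3) by (auto simp: closed_segment_vertical)
  then show ?thesis
    using assms by (simp add: vseg_def contour_integral_add contour_integrable_continuous_linepath add_divide_distrib)
qed

lemma hseg_bound:
  assumes "a \<le> b" "0 < \<gamma>" "0 < c" "0 \<le> K" "continuous_on {u. Im u = y \<and> a \<le> Re u \<and> Re u \<le> b} f"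
    and bound: "\<And>x. a \<le> x \<Longrightarrow> x \<le> b \<Longrightarrow> norm (f (Complex x y)) \<le> K * exp (\<gamma> * x - c * exp x)"
  shows "norm (hseg a b y f) \<le> K * (c powr (-\<gamma>) * Gamma \<gamma>)"
proof -
  have "continuous_on {a..b} (\<lambda>x. f (Complex x y))"
    by (rule continuous_on_compose2[OF assms(5)]) (auto simp: Complex_eq intro!: continuous_intros)
  then have "norm (hseg a b y f) \<le> integral {a..b} (\<lambda>x. K * exp (\<gamma> * x - c * exp x))"
    unfolding hseg_def using bound
    by (intro integral_norm_bound_integral integrable_continuous_real) (auto intro!: continuous_intros)
  also have "\<dots> \<le> K * (c powr (-\<gamma>) * Gamma \<gamma>)"
    using assms Gamma_exp_integral_le[of \<gamma> c a b] by (simp add: mult_left_mono)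
  finally show ?thesis .
qed

lemma two_div_two_pi_le:
  "0 \<le> W \<Longrightarrow> (W + W) / (2 * pi) \<le> W" for W :: real
  using mult_left_mono[of 1 pi W] pi_ge_two by (simp add: divide_le_eq)

text \<open>The form in which both asymptotic estimates are obtained: the horizontal integrals are
  bounded independently of the width of the rectangle, so the bound survives when both vertical
  sides move to infinity.\<close>

lemma vseg_limit_bound:
  assumes \<theta>: "0 < \<theta>" "\<theta> \<le> pi" "\<theta> < \<eta>" and "finite pts"
    and hol: "f holomorphic_on {u. \<bar>Im u\<bar> < \<eta>} - pts" and pts: "\<And>p. p \<in> pts \<Longrightarrow> \<bar>Im p\<bar> < \<theta>"
    and right: "(\<lambda>m. vseg \<theta> (real m) f) \<longlonglongrightarrow> L"
    and left: "(\<lambda>m. vseg \<theta> (- real m) f) \<longlonglongrightarrow> 0"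
    and "0 < \<gamma>" "0 < c" "0 \<le> K"
    and bound: "\<And>x y. \<bar>y\<bar> = \<theta> \<Longrightarrow> norm (f (Complex x y)) \<le> K * exp (\<gamma> * x - c * exp x)"
  shows "norm (L - (\<Sum>p\<in>pts. residue f p)) \<le> K * (c powr (-\<gamma>) * Gamma \<gamma>)"
proof -
  let ?R = "\<Sum>p\<in>pts. residue f p"
  define B where "B = K * (c powr (-\<gamma>) * Gamma \<gamma>)"
  have "B \<ge> 0" using assms by (simp add: B_def)
  \<comment> \<open>Beyond \<open>M\<close> the rectangle contains all poles, so the sum of residues
    no longer depends on m.\<close>
  obtain M :: nat where M: "\<And>p. p \<in> pts \<Longrightarrow> \<bar>Re p\<bar> \<le> real M"
  proof -
    obtain M :: nat where "Max (insert 0 ((\<lambda>p. \<bar>Re p\<bar>) ` pts)) \<le> real M" using real_arch_simple by blast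
    with \<open>finite pts\<close> have "\<bar>Re p\<bar> \<le> real M" if "p \<in> pts" for p using that by simp
    then show ?thesis by (rule that)
  qed
  have "norm (vseg \<theta> (real m) f - vseg \<theta> (- real m) f - ?R) \<le> B" if m: "m > M" for m
  proof -
    have cont: "continuous_on {u. Im u = y \<and> - real m \<le> Re u \<and> Re u \<le> real m} f" if "\<bar>y\<bar> = \<theta>" for y
      by (rule continuous_on_subset[OF holomorphic_on_imp_continuous_on[OF hol]]) (use that \<theta> pts in force)
    have h: "norm (hseg (- real m) (real m) y f) \<le> B" if "\<bar>y\<bar> = \<theta>" for y
      unfolding B_def by (rule hseg_bound) (use that assms cont in auto)
    have "vseg \<theta> (real m) f - vseg \<theta> (- real m) f - ?R
       = (hseg (- real m) (real m) \<theta> f - hseg (- real m) (real m) (-\<theta>) f) / (2 * of_real pi * \<i>)"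
      by (subst vseg_shift[of \<theta> \<eta> "- real m" "real m" pts f])
        (use assms m M in \<open>fastforce+\<close>)
    also have "norm \<dots> \<le> (B + B) / (2 * pi)"
      using h[of \<theta>] h[of "-\<theta>"] \<theta> \<open>B \<ge> 0\<close> unfolding norm_divide
      by (intro frac_le order_trans[OF norm_triangle_ineq4]) (auto simp: norm_mult)
    also have "\<dots> \<le> B" using \<open>B \<ge> 0\<close> by (rule two_div_two_pi_le)
    finally show ?thesis .
  qed
  then have "\<forall>\<^sub>F m in sequentially. norm (vseg \<theta> (real m) f - vseg \<theta> (- real m) f - ?R) \<le> B"
    by (rule eventually_mono[OF eventually_gt_at_top[of M]])
  moreover have "(\<lambda>m. norm (vseg \<theta> (real m) f - vseg \<theta> (- real m) f - ?R)) \<longlonglongrightarrow> norm (L - 0 - ?R)"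
    by (intro tendsto_intros right left)
  ultimately have "norm (L - 0 - ?R) \<le> B"
    by (intro tendsto_upperbound) auto
  then show ?thesis by (simp add: B_def)
qed

text \<open>Far to the right \<open>q u\<close> is small, and the geometric expansion of the kernel
  turns each power \<open>q u ^ k\<close> into a Hankel integral for the k-th coefficient. Tannery's
  theorem exchanges the limit in m with the sum over k.\<close>

lemma vseg_mittag_leffler:
  fixes z :: complex
  assumes \<rho>: "0 < \<rho>" and \<theta>: "pi / 2 < \<theta>" "\<theta> \<le> pi"
  shows "(\<lambda>m. vseg \<theta> (real m) (\<lambda>u. exp (exp u) / (1 - z * exp (- of_real (1 / \<rho>) * u))))
     \<longlonglongrightarrow> mittag_leffler \<rho> z"
proof -
  define \<alpha> where "\<alpha> = 1 / \<rho>"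
  define c where "c = - cos \<theta>"
  have "\<alpha> > 0" and "0 < \<theta>" using \<rho> \<theta> pi_gt_zero unfolding \<alpha>_def by auto
  have "c > 0" using \<theta> cos_monotone_0_pi[of "pi/2" \<theta>] by (simp add: c_def)
  define f where "f = (\<lambda>k u. z ^ k * exp (exp u + of_real (- \<alpha> * real k) * u))"
  define q where "q = (\<lambda>u. z * exp (- of_real \<alpha> * u))"
  have f_eq: "f k u = exp (exp u) * q u ^ k" for k u
  proof -
    have "exp (of_real (- \<alpha> * real k) * u) = exp (- of_real \<alpha> * u) ^ k"
      unfolding exp_of_nat_mult[symmetric] by (simp add: mult_ac)
    then show ?thesis by (simp only: f_def q_def power_mult_distrib exp_add) simp
  qed
  have f_hol: "f k holomorphic_on A" for k A unfolding f_def by (intro holomorphic_intros)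
  then have f_cont: "continuous_on A (f k)" for k A by (rule holomorphic_on_imp_continuous_on)
  have "(\<lambda>m. norm z * exp (- \<alpha> * real m)) \<longlonglongrightarrow> 0"
    using \<open>\<alpha> > 0\<close> by real_asymp
  then have "\<forall>\<^sub>F m in sequentially. norm z * exp (- \<alpha> * real m) < 1 / 2"
    by (rule order_tendstoD) simp
  then obtain M where M: "norm z * exp (- \<alpha> * real M) < 1 / 2"
    by (auto simp: eventually_sequentially)
  have norm_q: "norm (q u) \<le> 1 / 2" if "real M \<le> Re u" for u
  proof -
    have "norm (q u) = norm z * exp (- \<alpha> * Re u)" by (simp add: q_def norm_mult)
    also have "\<dots> \<le> norm z * exp (- \<alpha> * real M)"
      using that \<open>\<alpha> > 0\<close> by (intro mult_left_mono) auto
    finally show ?thesis using M by simp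
  qed
  have norm_f: "norm (f k u) \<le> exp (exp (Re u) * cos (Im u)) * (1 / 2) ^ k" if "real M \<le> Re u" for k u
    unfolding f_eq norm_mult norm_power using norm_q[OF that]
    by (intro mult_mono power_mono) (auto simp: Re_exp)
  define D where "D = exp (exp (real M)) + Gamma 1 / c"
  have D: "0 \<le> D" using \<open>c > 0\<close> by (simp add: D_def)
  \<comment> \<open>Tannery's theorem needs a bound independent of m, but on the segment itself the
    integrand may be as large as \<open>exp (exp m)\<close>. So the segment is moved back to
    abscissa \<open>M\<close>, at the cost of two horizontal integrals over lines where the cosine
    is \<open>- c\<close>.\<close>
  have bound: "norm (vseg \<theta> (real m) (f k)) \<le> D * (1 / 2) ^ k" if m: "M < m" for m k
  proof -
    have "norm (vseg \<theta> (real M) (f k)) \<le> exp (exp (real M)) * (1 / 2) ^ k"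
    proof (rule vseg_bound)
      fix u assume u: "Re u = real M"
      have "norm (f k u) \<le> exp (exp (Re u) * cos (Im u)) * (1 / 2) ^ k" using u by (intro norm_f) simp
      also have "\<dots> \<le> exp (exp (real M)) * (1 / 2) ^ k" using u by simp
      finally show "norm (f k u) \<le> exp (exp (real M)) * (1 / 2) ^ k" .
    qed (use \<open>0 < \<theta>\<close> \<theta> f_cont in auto)
    moreover have h: "norm (hseg (real M) (real m) y (f k)) \<le> (1 / 2) ^ k * (c powr (-1) * Gamma 1)"
      if y: "\<bar>y\<bar> = \<theta>" for y
    proof (rule hseg_bound)
      fix x assume x: "real M \<le> x"
      have "cos y = - c" using y by (metis c_def cos_abs_real minus_minus)
      then have "norm (f k (Complex x y)) \<le> (1 / 2) ^ k * exp (- c * exp x)"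
        using norm_f[of "Complex x y" k] x by (simp add: mult_ac)
      \<comment> \<open>The factor \<open>exp x\<close>, at least 1 since
        \<open>x \<ge> M \<ge> 0\<close>, is inserted to have a positive Gamma exponent 1 in
        \<open>hseg_bound\<close>.\<close>
      also have "\<dots> \<le> (1 / 2) ^ k * exp (1 * x - c * exp x)"
        using x by (intro mult_left_mono) auto
      finally show "norm (f k (Complex x y)) \<le> (1 / 2) ^ k * exp (1 * x - c * exp x)" .
    qed (use m \<open>c > 0\<close> f_cont in auto)
    moreover have "norm ((hseg (real M) (real m) \<theta> (f k) - hseg (real M) (real m) (-\<theta>) (f k)) / (2 * of_real pi * \<i>))
        \<le> ((1 / 2) ^ k * (c powr (-1) * Gamma 1) + (1 / 2) ^ k * (c powr (-1) * Gamma 1)) / (2 * pi)"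
      using h[of \<theta>] h[of "-\<theta>"] \<open>0 < \<theta>\<close> \<open>c > 0\<close> unfolding norm_divide
      by (intro frac_le order_trans[OF norm_triangle_ineq4]) (auto simp: norm_mult)
    moreover have "((1 / 2) ^ k * (c powr (-1) * Gamma 1) + (1 / 2) ^ k * (c powr (-1) * Gamma 1)) / (2 * pi)
        \<le> (1 / 2) ^ k * (c powr (-1) * Gamma 1)"
      by (rule two_div_two_pi_le) simp
    moreover have "norm (vseg \<theta> (real m) (f k)) \<le> norm (vseg \<theta> (real M) (f k))
       + norm ((hseg (real M) (real m) \<theta> (f k) - hseg (real M) (real m) (-\<theta>) (f k)) / (2 * of_real pi * \<i>))"
    proof -
      have "vseg \<theta> (real m) (f k) = vseg \<theta> (real M) (f k)
         + (hseg (real M) (real m) \<theta> (f k) - hseg (real M) (real m) (-\<theta>) (f k)) / (2 * of_real pi * \<i>)"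
        using vseg_shift[of \<theta> "\<theta> + 1" "real M" "real m" "{}" "f k"] \<open>0 < \<theta>\<close> m f_hol by simp
      then show ?thesis by (simp only: norm_triangle_ineq)
    qed
    ultimately have "norm (vseg \<theta> (real m) (f k)) \<le> exp (exp (real M)) * (1 / 2) ^ k + (1 / 2) ^ k * (c powr (-1) * Gamma 1)"
      by linarith
    also have "\<dots> = D * (1 / 2) ^ k"
    proof -
      have "c powr (-1) = 1 / c" using \<open>c > 0\<close> by (simp add: powr_minus_divide)
      then show ?thesis by (simp only: D_def) (simp add: distrib_right)
    qed
    finally show ?thesis .
  qed
  have series: "(\<lambda>k. vseg \<theta> (real m) (f k)) sums vseg \<theta> (real m) (\<lambda>u. exp (exp u) / (1 - q u))" if m: "M < m" for m
  proof -
    let ?A = "Complex (real m) (-\<theta>)" and ?B = "Complex (real m) \<theta>"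
    have seg: "closed_segment ?A ?B = {u. Re u = real m \<and> \<bar>Im u\<bar> \<le> \<theta>}"
      using \<open>0 < \<theta>\<close> by (auto simp: closed_segment_vertical)
    have q_less: "norm (q u) < 1" "norm (q u) \<le> 1 / 2" if "u \<in> closed_segment ?A ?B" for u
      using norm_q[of u] that m by (auto simp: seg)
    have "uniform_limit (closed_segment ?A ?B) (\<lambda>N u. \<Sum>k<N. f k u) (\<lambda>u. \<Sum>k. f k u) sequentially"
    proof (rule Weierstrass_m_test)
      fix k u assume u: "u \<in> closed_segment ?A ?B"
      then have "norm (f k u) \<le> exp (exp (Re u) * cos (Im u)) * (1 / 2) ^ k"
        using m by (intro norm_f) (simp add: seg)
      also have "\<dots> \<le> exp (exp (real m)) * (1 / 2) ^ k"
        using u by (simp add: seg)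
      finally show "norm (f k u) \<le> exp (exp (real m)) * (1 / 2) ^ k" .
    qed (auto intro!: summable_mult summable_geometric)
    moreover have "(\<Sum>k. f k u) = exp (exp u) / (1 - q u)" if "u \<in> closed_segment ?A ?B" for u
    proof -
      have "(\<lambda>k. exp (exp u) * q u ^ k) sums (exp (exp u) * (1 / (1 - q u)))"
        by (intro sums_mult geometric_sums q_less that)
      then show ?thesis by (simp add: f_eq sums_iff)
    qed
    ultimately have "uniform_limit (closed_segment ?A ?B) (\<lambda>N u. \<Sum>k<N. f k u) (\<lambda>u. exp (exp u) / (1 - q u)) sequentially"
      by (subst (asm) uniform_limit_cong') auto
    then obtain J where "((\<lambda>u. exp (exp u) / (1 - q u)) has_contour_integral J) (linepath ?A ?B)"
      "(\<lambda>k. contour_integral (linepath ?A ?B) (f k)) sums J"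
      by (rule contour_integral_sums_linepath[OF _ f_cont])
    then show ?thesis
      unfolding vseg_def by (simp add: contour_integral_unique sums_divide)
  qed
  have "(\<lambda>m. \<Sum>k. vseg \<theta> (real m) (f k)) \<longlonglongrightarrow> (\<Sum>k. z ^ k * of_real (rGamma (1 - (- \<alpha> * real k))))"
  proof (rule tannerys_theorem[THEN conjunct2, THEN conjunct2])
    fix k
    have "vseg \<theta> b (f k) = z ^ k * vseg \<theta> b (\<lambda>u. exp (exp u + of_real (- \<alpha> * real k) * u))" for b
      unfolding vseg_def f_def
      by (subst contour_integral_lmul) (auto intro!: contour_integrable_continuous_linepath continuous_intros)
    then show "(\<lambda>m. vseg \<theta> (real m) (f k)) \<longlonglongrightarrow> z ^ k * of_real (rGamma (1 - (- \<alpha> * real k)))"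
      by (simp only:) (intro tendsto_mult tendsto_const vseg_hankel_angle \<theta>)
  next
    show "\<forall>\<^sub>F (k, m) in sequentially \<times>\<^sub>F sequentially. norm (vseg \<theta> (real m) (f k)) \<le> D * (1 / 2) ^ k"
      unfolding eventually_prod_filter
      by (intro exI[of _ "\<lambda>_. True"] exI[of _ "\<lambda>m. M < m"]) (auto intro: bound eventually_gt_at_top)
  qed (auto intro!: summable_mult summable_geometric)
  moreover have "(\<Sum>k. z ^ k * of_real (rGamma (1 - (- \<alpha> * real k)))) = mittag_leffler \<rho> z"
    by (simp add: mittag_leffler_def \<alpha>_def rGamma_inverse_Gamma divide_inverse mult_ac)
  moreover have "\<forall>\<^sub>F m in sequentially. (\<Sum>k. vseg \<theta> (real m) (f k)) = vseg \<theta> (real m) (\<lambda>u. exp (exp u) / (1 - q u))"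
    using eventually_gt_at_top[of M] by eventually_elim (simp add: sums_unique[OF series])
  ultimately show ?thesis
    unfolding q_def \<alpha>_def by (auto intro: Lim_transform_eventually)
qed

section \<open>Lower bounds for the denominator of the kernel\<close>

text \<open>Needed beyond the interval from -\<pi> to \<pi>, because the argument
  \<open>Arg z - \<alpha> * Im u\<close> of the kernel ratio can leave it.\<close>

lemma cos_le_cos_gap:
  assumes "0 \<le> \<eta>" "\<eta> \<le> pi" "\<eta> \<le> \<bar>\<psi>\<bar>" "\<bar>\<psi>\<bar> \<le> 2 * pi - \<eta>"
  shows "cos \<psi> \<le> cos \<eta>"
proof (cases "\<bar>\<psi>\<bar> \<le> pi")
  case True
  then show ?thesis using cos_monotone_0_pi_le[of \<eta> "\<bar>\<psi>\<bar>"] assms by simp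
next
  case False
  have "cos \<psi> = cos (2 * pi - \<bar>\<psi>\<bar>)" by simp
  also have "\<dots> \<le> cos \<eta>" using False assms by (intro cos_monotone_0_pi_le) auto
  finally show ?thesis .
qed

text \<open>By the law of cosines the squared distance only shrinks when \<psi> is replaced by
  \<eta>; completing the square then gives
  \<open>(t - cos \<eta>)\<^sup>2 + (sin \<eta>)\<^sup>2\<close>.\<close>

lemma sin_le_norm_one_minus_rcis:
  assumes "0 \<le> t" "cos \<psi> \<le> cos \<eta>"
  shows "sin \<eta> \<le> norm (1 - rcis t \<psi>)"
proof (rule power2_le_imp_le)
  have "(sin \<eta>)\<^sup>2 \<le> (t - cos \<eta>)\<^sup>2 + (sin \<eta>)\<^sup>2" by simp
  also have "\<dots> = 1 - 2 * t * cos \<eta> + t\<^sup>2"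
    by (simp add: power2_eq_square algebra_simps)
  also have "\<dots> \<le> 1 - 2 * t * cos \<psi> + t\<^sup>2"
    using assms by (simp add: mult_left_mono)
  also have "\<dots> = (1 - t * cos \<psi>)\<^sup>2 + (t * sin \<psi>)\<^sup>2"
    using sin_cos_squared_add[of \<psi>] by algebra
  also have "\<dots> = (norm (1 - rcis t \<psi>))\<^sup>2"
    by (simp add: cmod_power2)
  finally show "(sin \<eta>)\<^sup>2 \<le> (norm (1 - rcis t \<psi>))\<^sup>2" .
qed simp

context
  fixes \<alpha> :: real and z :: complex
  assumes \<alpha>: "0 < \<alpha>" and z: "z \<noteq> 0"
begin

lemma kernel_ratio_rcis: "z * exp (- of_real \<alpha> * u) = rcis (norm z * exp (- \<alpha> * Re u)) (Arg z - \<alpha> * Im u)"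
proof -
  have "z * exp (- of_real \<alpha> * u) = rcis (norm z) (Arg z) * rcis (exp (- \<alpha> * Re u)) (- \<alpha> * Im u)"
    by (simp add: rcis_cmod_Arg) (simp add: exp_eq_polar rcis_def)
  then show ?thesis by (simp add: rcis_mult)
qed

text \<open>The distance bound is applied to the inverse of \<open>q\<close>, since
  \<open>norm (1 - q) = norm q * norm (1 - 1 / q)\<close>. The factor \<open>norm q\<close> gained
  in this way yields the decay in \<open>norm z\<close> and makes the horizontal integrals converge
  at the far left.\<close>

lemma norm_one_minus_kernel_ratio_ge:
  assumes "cos (Arg z - \<alpha> * Im u) \<le> cos \<eta>"
  shows "norm (z * exp (- of_real \<alpha> * u)) * sin \<eta> \<le> norm (1 - z * exp (- of_real \<alpha> * u))"
proof -
  define q where "q = z * exp (- of_real \<alpha> * u)"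
  have "q \<noteq> 0" using z by (simp add: q_def)
  have "cos (- (Arg z - \<alpha> * Im u)) \<le> cos \<eta>" using assms unfolding cos_minus .
  then have "sin \<eta> \<le> norm (1 - rcis (inverse (norm z * exp (- \<alpha> * Re u))) (- (Arg z - \<alpha> * Im u)))"
    by (intro sin_le_norm_one_minus_rcis) auto
  also have "rcis (inverse (norm z * exp (- \<alpha> * Re u))) (- (Arg z - \<alpha> * Im u)) = inverse q"
    unfolding q_def kernel_ratio_rcis rcis_inverse by (simp only: inverse_eq_divide)
  finally have "norm q * sin \<eta> \<le> norm q * norm (1 - inverse q)"
    by (rule mult_left_mono) simp
  also have "\<dots> = norm (1 - q)"
    using \<open>q \<noteq> 0\<close> by (simp add: norm_mult[symmetric] right_diff_distrib norm_minus_commute)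
  finally show ?thesis by (simp add: q_def)
qed

text \<open>To the left \<open>norm q\<close> grows like \<open>exp (\<alpha> * m)\<close>, so the
  denominator is at least half of it, while \<open>exp (exp u)\<close> stays bounded.\<close>

lemma kernel_left_limit:
  assumes \<theta>: "0 < \<theta>" "\<theta> \<le> pi"
  shows "(\<lambda>m. vseg \<theta> (- real m) (\<lambda>u. exp (exp u) / (1 - z * exp (- of_real \<alpha> * u)))) \<longlonglongrightarrow> 0"
    "\<forall>\<^sub>F m in sequentially. continuous_on {u. Re u = - real m} (\<lambda>u. exp (exp u) / (1 - z * exp (- of_real \<alpha> * u)))"
proof -
  define q where "q = (\<lambda>u. z * exp (- of_real \<alpha> * u))"
  have "filterlim (\<lambda>m. norm z * exp (\<alpha> * real m)) at_top sequentially"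
    using \<alpha> z by real_asymp
  then have large: "\<forall>\<^sub>F m in sequentially. 2 \<le> norm z * exp (\<alpha> * real m)"
    by (rule filterlim_at_top[THEN iffD1, rule_format])
  have q: "norm z * exp (\<alpha> * real m) / 2 \<le> norm (1 - q u)" "1 - q u \<noteq> 0"
    if "2 \<le> norm z * exp (\<alpha> * real m)" "Re u = - real m" for u m
  proof -
    have "norm (q u) = norm z * exp (\<alpha> * real m)" using that by (simp add: q_def norm_mult)
    then show 1: "norm z * exp (\<alpha> * real m) / 2 \<le> norm (1 - q u)"
      using norm_triangle_ineq2[of "q u" 1] that by (simp add: norm_minus_commute)
    with that show "1 - q u \<noteq> 0" by fastforce
  qed
  have cont: "continuous_on {u. Re u = - real m} (\<lambda>u. exp (exp u) / (1 - q u))"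
    if "2 \<le> norm z * exp (\<alpha> * real m)" for m
    using q(2)[OF that] unfolding q_def by (intro continuous_intros) auto
  show "\<forall>\<^sub>F m in sequentially. continuous_on {u. Re u = - real m} (\<lambda>u. exp (exp u) / (1 - z * exp (- of_real \<alpha> * u)))"
    using large by eventually_elim (use cont in \<open>simp add: q_def\<close>)
  have "(\<lambda>m. vseg \<theta> (- real m) (\<lambda>u. exp (exp u) / (1 - q u))) \<longlonglongrightarrow> 0"
  proof (rule Lim_null_comparison)
    show "\<forall>\<^sub>F m in sequentially. norm (vseg \<theta> (- real m) (\<lambda>u. exp (exp u) / (1 - q u)))
        \<le> exp (exp (- real m)) / (norm z * exp (\<alpha> * real m) / 2)"
      using large
    proof eventually_elim
      case (elim m)
      show ?case
      proof (rule vseg_bound)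
        fix u :: complex assume u: "Re u = - real m"
        have "norm (exp (exp u)) \<le> exp (exp (- real m))"
          using norm_exp[of "exp u"] u by (simp add: norm_exp_eq_Re[of u])
        then show "norm (exp (exp u) / (1 - q u)) \<le> exp (exp (- real m)) / (norm z * exp (\<alpha> * real m) / 2)"
          unfolding norm_divide using q[OF elim u] z by (intro frac_le) (auto simp del: norm_exp_eq_Re)
      qed (use \<theta> in \<open>auto intro: continuous_on_subset[OF cont[OF elim]]\<close>)
    qed
    show "(\<lambda>m. exp (exp (- real m)) / (norm z * exp (\<alpha> * real m) / 2)) \<longlonglongrightarrow> 0"
      using \<alpha> z by real_asymp
  qed
  then show "(\<lambda>m. vseg \<theta> (- real m) (\<lambda>u. exp (exp u) / (1 - z * exp (- of_real \<alpha> * u)))) \<longlonglongrightarrow> 0"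
    by (simp add: q_def)
qed

end

section \<open>The two asymptotic estimates of the Mittag-Leffler function\<close>

text \<open>The contour has height \<pi>, where the integrand is at most
  \<open>exp (\<alpha> * x - exp x)\<close> divided by
  \<open>norm z * sin (pi / (2 * \<rho>))\<close>; integrating gives
  \<open>Gamma (1 / \<rho>)\<close>. The estimate is absolute and includes the bounding rays, on
  which the exponential has modulus 1.\<close>

lemma mittag_leffler_exp_asymp:
  assumes \<rho>: "1 < \<rho>" and z: "z \<noteq> 0" "\<bar>Arg z\<bar> \<le> pi / (2 * \<rho>)"
  shows "norm (mittag_leffler \<rho> z - of_real \<rho> * exp (z powr of_real \<rho>))
    \<le> Gamma (1 / \<rho>) / sin (pi / (2 * \<rho>)) / norm z"
proof -
  define \<alpha> where "\<alpha> = 1 / \<rho>"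
  have \<alpha>: "0 < \<alpha>" "\<alpha> < 1" using \<rho> by (auto simp: \<alpha>_def)
  define \<eta> where "\<eta> = \<alpha> * pi / 2"
  have Arg: "\<bar>Arg z\<bar> \<le> \<eta>" and sin_eq: "sin (pi / (2 * \<rho>)) = sin \<eta>" using z by (simp_all add: \<eta>_def \<alpha>_def mult.commute)
  have \<eta>: "0 < \<eta>" "\<eta> < pi / 2" using \<alpha> by (auto simp: \<eta>_def)
  then have "sin \<eta> > 0" by (intro sin_gt_zero) auto
  define q where "q = (\<lambda>u. z * exp (- of_real \<alpha> * u))"
  \<comment> \<open>The solution of \<open>q u = 1\<close> coming from the principal logarithm of
    \<open>z\<close>. Thus \<open>exp u0\<close> is the principal power
    \<open>z powr \<rho>\<close>.\<close>
  define u0 where "u0 = of_real \<rho> * Ln z"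
  have \<alpha>u0: "of_real \<alpha> * u0 = Ln z" using \<rho> by (simp add: u0_def \<alpha>_def)
  have q_u0: "q u0 = 1"
    using z by (simp add: q_def \<alpha>u0 exp_minus)
  let ?f = "\<lambda>u. exp (exp u) / (1 - q u)"
  \<comment> \<open>The strip must be wider than \<pi> and still contain no other zero. For a zero
    \<open>u\<close> in it \<open>\<alpha> * \<bar>Im u - Im u0\<bar>\<close> is below \<open>3 / 2
    * \<alpha> * pi + \<alpha> * pi / 2 = 2 * \<alpha> * pi\<close>, hence below 2 \<pi>, whereas
    distinct zeros differ there by at least 2 \<pi>.\<close>
  let ?S = "{u. \<bar>Im u\<bar> < 3 / 2 * pi}"
  have S_eq: "?S = {u. - (3 / 2 * pi) < Im u} \<inter> {u. Im u < 3 / 2 * pi}" by auto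
  have Im_u0: "\<bar>\<alpha> * Im u0\<bar> \<le> \<eta>"
    using arg_cong[OF \<alpha>u0, of Im] Arg z by (simp add: Arg_eq_Im_Ln)
  then have "\<alpha> * \<bar>Im u0\<bar> \<le> \<alpha> * (pi / 2)" using \<alpha> by (simp add: abs_mult \<eta>_def)
  then have Im_u0': "\<bar>Im u0\<bar> \<le> pi / 2" using \<alpha> by (simp add: mult_le_cancel_left)
  have zeros: "u = u0" if "q u = 1" "u \<in> ?S" for u
  proof -
    have "exp (of_real \<alpha> * u) = exp (of_real \<alpha> * u0)"
      using that q_u0 z by (simp add: q_def exp_minus divide_simps)
    then obtain n :: int where n: "of_real \<alpha> * u = of_real \<alpha> * u0 + of_int (2 * n) * of_real pi * \<i>"
      by (auto simp: exp_eq)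
    from arg_cong[OF n, of Im] have "\<alpha> * Im u = \<alpha> * Im u0 + 2 * pi * of_int n" by simp
    moreover have "\<bar>\<alpha> * Im u\<bar> < \<alpha> * (3 / 2 * pi)" using that \<alpha> by (simp add: abs_mult)
    moreover note Im_u0
    moreover have "\<bar>2 * pi * of_int n\<bar> = 2 * pi * \<bar>of_int n\<bar>" by (simp add: abs_mult)
    ultimately have "2 * pi * \<bar>of_int n\<bar> < \<alpha> * (3 / 2 * pi) + \<alpha> * pi / 2"
      unfolding \<eta>_def by linarith
    also have "\<dots> < 2 * pi * 1" using \<alpha> by (simp add: algebra_simps)
    finally have "n = 0" by (simp add: mult_less_cancel_left)
    with n \<alpha> show ?thesis by simp
  qed
  have "norm (mittag_leffler \<rho> z - (\<Sum>p\<in>{u0}. residue ?f p)) \<le> 1 / (norm z * sin \<eta>) * (1 powr (-\<alpha>) * Gamma \<alpha>)"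
  proof (rule vseg_limit_bound[where \<theta> = pi and \<eta> = "3 / 2 * pi"])
    show "?f holomorphic_on ?S - {u0}"
      using zeros unfolding q_def by (intro holomorphic_intros) auto
    show "(\<lambda>m. vseg pi (real m) ?f) \<longlonglongrightarrow> mittag_leffler \<rho> z"
      unfolding q_def \<alpha>_def by (rule vseg_mittag_leffler) (use \<rho> in auto)
    show "(\<lambda>m. vseg pi (- real m) ?f) \<longlonglongrightarrow> 0"
      unfolding q_def by (rule kernel_left_limit) (use \<alpha> z in auto)
    show "norm (?f (Complex x y)) \<le> 1 / (norm z * sin \<eta>) * exp (\<alpha> * x - 1 * exp x)" if y: "\<bar>y\<bar> = pi" for x y
    proof -
      \<comment> \<open>On the horizontal lines \<open>\<alpha> * y\<close> has modulus 2 \<eta>,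
        while \<open>Arg z\<close> has modulus at most \<eta>. The difference lies between \<eta>
        and 3 \<eta> in modulus, and 4 \<eta> < 2 \<pi>.\<close>
      have "cos (Arg z - \<alpha> * y) \<le> cos \<eta>"
      proof (rule cos_le_cos_gap)
        have ay: "\<bar>\<alpha> * y\<bar> = 2 * \<eta>" using y \<alpha> by (simp add: abs_mult \<eta>_def)
        show "\<eta> \<le> \<bar>Arg z - \<alpha> * y\<bar>" using ay Arg by linarith
        have "\<bar>Arg z - \<alpha> * y\<bar> \<le> 3 * \<eta>" using ay Arg by linarith
        also have "\<dots> \<le> 2 * pi - \<eta>" using \<eta> by simp
        finally show "\<bar>Arg z - \<alpha> * y\<bar> \<le> 2 * pi - \<eta>" .
      qed (use \<eta> in auto)
      then have "norm (q (Complex x y)) * sin \<eta> \<le> norm (1 - q (Complex x y))"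
        unfolding q_def using norm_one_minus_kernel_ratio_ge[of \<alpha> z "Complex x y" \<eta>] \<alpha> z by simp
      moreover have "norm (q (Complex x y)) = norm z * exp (- \<alpha> * x)"
        by (simp add: q_def norm_mult)
      moreover have "cos y = -1" using y by (metis cos_abs_real cos_pi)
      then have "norm (exp (exp (Complex x y))) = exp (- exp x)"
        by (simp add: Re_exp)
      ultimately have "norm (?f (Complex x y)) \<le> exp (- exp x) / (norm z * exp (- \<alpha> * x) * sin \<eta>)"
        unfolding norm_divide using z \<open>sin \<eta> > 0\<close> by (intro frac_le) auto
      then show ?thesis by (simp add: exp_diff exp_minus field_simps)
    qed
  next
    show "\<bar>Im p\<bar> < pi" if "p \<in> {u0}" for p
      using that Im_u0' pi_gt_zero by (simp only: singleton_iff)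
  qed (use \<alpha> \<open>sin \<eta> > 0\<close> in auto)
  \<comment> \<open>At its zero \<open>u0\<close> the function \<open>1 - q\<close> has derivative
    \<alpha>, so the residue is \<open>exp (exp u0)\<close> divided by \<alpha>, that is, multiplied
    by \<rho>.\<close>
  moreover have "residue ?f u0 = exp (exp u0) / of_real \<alpha>"
  proof (rule residue_simple_pole_deriv[where s = UNIV])
    show "((\<lambda>u. 1 - q u) has_field_derivative of_real \<alpha>) (at u0)"
      unfolding q_def by (rule derivative_eq_intros refl)+ (use q_u0 in \<open>simp add: q_def mult.commute\<close>)
  qed (use \<alpha> q_u0 in \<open>auto simp: q_def intro!: holomorphic_intros\<close>)
  ultimately have "norm (mittag_leffler \<rho> z - exp (exp u0) / of_real \<alpha>) \<le> 1 / (norm z * sin \<eta>) * Gamma \<alpha>"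
    by simp
  moreover have "exp u0 = z powr of_real \<rho>" using z by (simp add: u0_def powr_def)
  ultimately show ?thesis
    by (simp add: \<alpha>_def \<eta>_def mult.commute)
qed

text \<open>Write 1/(1 - q) = -1/q + 1/(q (1 - q)). The first term is a multiple of
  \<open>exp (\<alpha> * u)\<close> and gives exactly \<open>- rGamma (1 - \<alpha>) / z\<close> by
  Hankel's formula. The second is of order \<open>1 / (norm q)\<^sup>2\<close>, and no pole is
  enclosed.\<close>

lemma mittag_leffler_inverse_asymp:
  assumes \<rho>: "1 < \<rho>" and \<delta>: "0 < \<delta>"
  obtains C where "0 \<le> C" "\<And>z. z \<noteq> 0 \<Longrightarrow> pi / (2 * \<rho>) + \<delta> \<le> \<bar>Arg z\<bar> \<Longrightarrow>
    norm (mittag_leffler \<rho> z + of_real (rGamma (1 - 1 / \<rho>)) / z) \<le> C / (norm z)\<^sup>2"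
proof -
  define \<alpha> where "\<alpha> = 1 / \<rho>"
  have \<alpha>: "0 < \<alpha>" "\<alpha> < 1" using \<rho> by (auto simp: \<alpha>_def)
  \<comment> \<open>The height has to exceed \<pi>/2 for decay to the right. Half of the available
    gap \<delta> is spent on this, and the other half keeps \<open>Arg z - \<alpha> * y\<close> at
    least \<delta>/2 from 0. The cap at \<pi> is the range of Hankel's formula.\<close>
  define \<theta> where "\<theta> = min pi (pi / 2 + \<delta> / (2 * \<alpha>))"
  have \<theta>: "pi / 2 < \<theta>" "\<theta> \<le> pi" using \<delta> \<alpha> by (auto simp: \<theta>_def)
  then have \<theta>_pos: "0 < \<theta>" using pi_gt_zero by linarith
  have "\<alpha> * \<theta> \<le> \<alpha> * (pi / 2 + \<delta> / (2 * \<alpha>))" using \<alpha> by (intro mult_left_mono) (auto simp: \<theta>_def)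
  then have \<alpha>\<theta>: "\<alpha> * \<theta> \<le> \<alpha> * pi / 2 + \<delta> / 2" using \<alpha> by (simp add: distrib_left)
  define c where "c = - cos \<theta>"
  have "c > 0" using \<theta> cos_monotone_0_pi[of "pi/2" \<theta>] by (simp add: c_def)
  \<comment> \<open>The constant must not depend on \<open>z\<close>, but only the existence of some
    admissible \<open>z\<close> shows \<delta> < \<pi> and thus
    \<open>sin (\<delta> / 2) > 0\<close>. The absolute value makes \<open>C\<close> nonnegative in
    any case.\<close>
  define C where "C = \<bar>1 / sin (\<delta> / 2)\<bar> * (c powr (- (2 * \<alpha>)) * Gamma (2 * \<alpha>))"
  have "norm (mittag_leffler \<rho> z + of_real (rGamma (1 - 1 / \<rho>)) / z) \<le> C / (norm z)\<^sup>2"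
    if z: "z \<noteq> 0" "pi / (2 * \<rho>) + \<delta> \<le> \<bar>Arg z\<bar>" for z
  proof -
    have Arg: "\<alpha> * pi / 2 + \<delta> \<le> \<bar>Arg z\<bar>" using z by (simp add: \<alpha>_def)
    have Arg_pi: "\<bar>Arg z\<bar> \<le> pi" using Arg_bounded[of z] by auto
    have "0 < \<alpha> * pi / 2" using \<alpha> by simp
    with Arg Arg_pi have \<delta>_pi: "\<delta> < pi" by linarith
    have "sin (\<delta> / 2) > 0" using \<delta> \<delta>_pi by (intro sin_gt_zero) auto
    define q where "q = (\<lambda>u. z * exp (- of_real \<alpha> * u))"
    have q_nz: "q u \<noteq> 0" for u using z by (simp add: q_def)
    have q_inv: "1 / q u = exp (of_real \<alpha> * u) / z" for u by (simp add: q_def exp_minus field_simps)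
    define E1 where "E1 = (\<lambda>u. exp (exp u) / (1 - q u))"
    define E2 where "E2 = (\<lambda>u. exp (exp u + of_real \<alpha> * u) / z)"
    let ?f = "\<lambda>u. E1 u + E2 u"
    let ?S = "{u. \<bar>Im u\<bar> < \<bar>Arg z\<bar> / \<alpha>}"
    have E2_vseg: "vseg \<theta> b E2 = vseg \<theta> b (\<lambda>u. exp (exp u + of_real \<alpha> * u)) / z" for b
      unfolding vseg_def E2_def
      by (subst contour_integral_div) (auto intro!: contour_integrable_continuous_linepath continuous_intros)
    have E2_cont: "continuous_on A E2" for A unfolding E2_def using z by (intro continuous_intros) auto
    \<comment> \<open>At a zero \<open>\<alpha> * Im u\<close> is congruent to \<open>Arg z\<close>
      modulo 2 \<pi>. The representative of least modulus is \<open>Arg z\<close> itself, so every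
      zero has \<open>\<bar>Im u\<bar> \<ge> \<bar>Arg z\<bar> / \<alpha>\<close>.\<close>
    have zero_free: "q u \<noteq> 1" if u: "\<bar>Im u\<bar> < \<bar>Arg z\<bar> / \<alpha>" for u
    proof
      assume "q u = 1"
      then have "exp (of_real \<alpha> * u) = exp (Ln z)"
        using z by (simp add: q_def exp_minus divide_simps)
      then obtain n :: int where n: "of_real \<alpha> * u = Ln z + of_int (2 * n) * of_real pi * \<i>"
        by (auto simp: exp_eq)
      from arg_cong[OF n, of Im] have eq: "\<alpha> * Im u = Arg z + 2 * pi * of_int n"
        using z by (simp add: Arg_eq_Im_Ln)
      have less: "\<bar>\<alpha> * Im u\<bar> < \<bar>Arg z\<bar>" using u \<alpha> by (simp add: abs_mult field_simps)
      moreover have "\<bar>2 * pi * of_int n\<bar> = 2 * pi * \<bar>of_int n\<bar>" by (simp add: abs_mult)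
      ultimately have "2 * pi * \<bar>of_int n\<bar> < 2 * pi * 1"
        using eq Arg_pi by linarith
      then have "n = 0" by (simp add: mult_less_cancel_left)
      with eq less show False by simp
    qed
    have "\<theta> < \<bar>Arg z\<bar> / \<alpha>" using \<alpha>\<theta> Arg \<delta> \<alpha> by (simp add: field_simps)
    have E1_cont: "continuous_on {u. Re u = b \<and> \<bar>Im u\<bar> \<le> \<theta>} E1" for b
      unfolding E1_def q_def using zero_free \<open>\<theta> < \<bar>Arg z\<bar> / \<alpha>\<close>
      by (intro continuous_intros) (force simp: q_def)
    have vseg_f: "vseg \<theta> b ?f = vseg \<theta> b E1 + vseg \<theta> b (\<lambda>u. exp (exp u + of_real \<alpha> * u)) / z" for b
      unfolding E2_vseg[symmetric] using \<theta>_pos by (intro vseg_add E1_cont E2_cont) auto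
    have "norm (mittag_leffler \<rho> z + of_real (rGamma (1 - \<alpha>)) / z - (\<Sum>p\<in>{}. residue ?f p))
        \<le> 1 / ((norm z)\<^sup>2 * sin (\<delta> / 2)) * (c powr (- (2 * \<alpha>)) * Gamma (2 * \<alpha>))"
    proof (rule vseg_limit_bound[OF \<theta>_pos \<theta>(2) \<open>\<theta> < \<bar>Arg z\<bar> / \<alpha>\<close>])
      show "?f holomorphic_on ?S - {}"
        unfolding E1_def E2_def q_def using zero_free z by (intro holomorphic_intros) (auto simp: q_def)
      show "(\<lambda>m. vseg \<theta> (real m) ?f) \<longlonglongrightarrow> mittag_leffler \<rho> z + of_real (rGamma (1 - \<alpha>)) / z"
        unfolding vseg_f
      proof (intro tendsto_add tendsto_divide tendsto_const vseg_hankel_angle \<theta> z)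
        show "(\<lambda>m. vseg \<theta> (real m) E1) \<longlonglongrightarrow> mittag_leffler \<rho> z"
          unfolding E1_def q_def \<alpha>_def by (rule vseg_mittag_leffler) (use \<rho> \<theta> in auto)
      qed
      have "(\<lambda>m. vseg \<theta> (- real m) E1 + vseg \<theta> (- real m) (\<lambda>u. exp (exp u + of_real \<alpha> * u)) / z) \<longlonglongrightarrow> 0 + 0 / z"
      proof (intro tendsto_add tendsto_divide tendsto_const vseg_hankel_left \<theta> \<theta>_pos \<alpha> z)
        show "(\<lambda>m. vseg \<theta> (- real m) E1) \<longlonglongrightarrow> 0"
          unfolding E1_def q_def by (rule kernel_left_limit) (use \<alpha> z \<theta> \<theta>_pos in auto)
      qed
      then show "(\<lambda>m. vseg \<theta> (- real m) ?f) \<longlonglongrightarrow> 0"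
        unfolding vseg_f by simp
      show "norm (?f (Complex x y)) \<le> 1 / ((norm z)\<^sup>2 * sin (\<delta> / 2)) * exp (2 * \<alpha> * x - c * exp x)"
        if y: "\<bar>y\<bar> = \<theta>" for x y
      proof -
        let ?u = "Complex x y"
        have "cos (Arg z - \<alpha> * y) \<le> cos (\<delta> / 2)"
        proof (rule cos_le_cos_gap)
          have ay: "\<bar>\<alpha> * y\<bar> \<le> \<alpha> * pi / 2 + \<delta> / 2" using y \<alpha> \<alpha>\<theta> by (simp add: abs_mult)
          show "\<delta> / 2 \<le> \<bar>Arg z - \<alpha> * y\<bar>" using ay Arg by linarith
          show "\<bar>Arg z - \<alpha> * y\<bar> \<le> 2 * pi - \<delta> / 2" using ay Arg Arg_pi \<delta> by linarith
        qed (use \<delta> \<delta>_pi in auto)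
        then have 1: "norm (q ?u) * sin (\<delta> / 2) \<le> norm (1 - q ?u)"
          unfolding q_def using norm_one_minus_kernel_ratio_ge[of \<alpha> z ?u "\<delta> / 2"] \<alpha> z by simp
        have 2: "norm (q ?u) = norm z * exp (- \<alpha> * x)"
          by (simp add: q_def norm_mult)
        have "cos y = - c" using y by (metis c_def cos_abs_real minus_minus)
        then have 3: "norm (exp (exp ?u)) = exp (- c * exp x)"
          by (simp add: Re_exp mult.commute)
        have "1 - q ?u \<noteq> 0" using zero_free[of ?u] y \<open>\<theta> < \<bar>Arg z\<bar> / \<alpha>\<close> by auto
        moreover have "?f ?u = exp (exp ?u) * (1 / (1 - q ?u) + 1 / q ?u)"
          unfolding q_inv by (simp add: E1_def E2_def exp_add distrib_left)
        moreover have "1 / (1 - q ?u) + 1 / q ?u = 1 / (q ?u * (1 - q ?u))"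
          using calculation(1) q_nz[of ?u] by (simp add: field_simps)
        ultimately have "?f ?u = exp (exp ?u) / (q ?u * (1 - q ?u))"
          by simp
        then have "norm (?f ?u) = exp (- c * exp x) / (norm (q ?u) * norm (1 - q ?u))"
          by (simp add: norm_divide norm_mult 3 del: norm_exp_eq_Re)
        also have "\<dots> \<le> exp (- c * exp x) / (norm (q ?u) * (norm (q ?u) * sin (\<delta> / 2)))"
          using q_nz \<open>sin (\<delta> / 2) > 0\<close> 1 by (intro divide_left_mono mult_left_mono mult_pos_pos) (auto intro: less_le_trans[rotated])
        also have "\<dots> = 1 / ((norm z)\<^sup>2 * sin (\<delta> / 2)) * exp (2 * \<alpha> * x - c * exp x)"
          unfolding 2 by (simp add: exp_diff exp_minus power2_eq_square field_simps flip: exp_add)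
        finally show ?thesis .
      qed
    qed (use \<alpha> \<open>c > 0\<close> \<open>sin (\<delta> / 2) > 0\<close> in auto)
    also have "\<dots> = C / (norm z)\<^sup>2"
      using \<open>sin (\<delta> / 2) > 0\<close> by (simp add: C_def)
    finally show ?thesis by (simp add: \<alpha>_def)
  qed
  moreover have "0 \<le> C" using \<alpha> by (simp add: C_def)
  ultimately show ?thesis using that by blast
qed

section \<open>Sections and tails\<close>

lemma uniform_limit_mult_bounded_below:
  fixes f g :: "nat \<Rightarrow> complex \<Rightarrow> complex"
  assumes "0 < c" and c: "\<And>z. z \<in> S \<Longrightarrow> c \<le> norm (h z)"
    and small: "\<And>\<epsilon>. 0 < \<epsilon> \<Longrightarrow> \<forall>\<^sub>F n in sequentially. \<forall>z\<in>S. norm (h z * g n z) < \<epsilon>"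
  shows "uniform_limit S g (\<lambda>_. 0) sequentially"
proof (rule uniform_limitI)
  fix \<epsilon> :: real assume "0 < \<epsilon>"
  then have "\<forall>\<^sub>F n in sequentially. \<forall>z\<in>S. norm (h z * g n z) < c * \<epsilon>"
    using \<open>0 < c\<close> by (intro small) simp
  then show "\<forall>\<^sub>F n in sequentially. \<forall>z\<in>S. dist (g n z) 0 < \<epsilon>"
  proof eventually_elim
    case (elim n)
    show ?case
    proof
      fix z assume z: "z \<in> S"
      have "c * norm (g n z) \<le> norm (h z * g n z)"
        using c[OF z] by (simp add: norm_mult mult_right_mono)
      also have "\<dots> < c * \<epsilon>" using elim z by simp
      finally show "dist (g n z) 0 < \<epsilon>" using \<open>0 < c\<close> by simp
    qed
  qed
qed

text \<open>The region is unbounded, so dividing \<open>norm (z - 1)\<close> by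
  \<open>norm z\<close> helps only for \<open>norm z \<le> 2\<close>; beyond that
  \<open>1 / z\<close> is itself at most 1/2 in modulus.\<close>

lemma norm_one_minus_inverse_ge:
  fixes z :: complex
  assumes "0 < \<delta>" "1 \<le> norm z" "\<delta> \<le> norm (z - 1)"
  shows "min (1 / 2) (\<delta> / 2) \<le> norm (1 - 1 / z)"
proof (cases "norm z \<le> 2")
  case True
  have "z \<noteq> 0" using assms by auto
  then have "norm (1 - 1 / z) = norm (z - 1) / norm z"
    by (simp add: norm_divide[symmetric] diff_divide_distrib)
  also have "\<dots> \<ge> \<delta> / 2" using assms True by (intro frac_le) auto
  finally show ?thesis by simp
next
  case False
  then have "norm (1 / z) \<le> 1 / 2" using frac_le[of 1 1 2 "norm z"] by (simp add: norm_divide)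
  then show ?thesis using norm_triangle_ineq2[of 1 "1 / z"] by simp
qed

section \<open>Growth of the scaling radii\<close>

context
  fixes \<rho> :: real
  assumes \<rho>: "1 < \<rho>"
begin

private abbreviation (input) "G n \<equiv> Gamma (1 + real n / \<rho>)"
private abbreviation (input) "R \<equiv> radius_scale \<rho>"
text \<open>The reciprocal of the degree-n term of the series at \<open>R n * z\<close>. For n >= 1
  the choice of \<open>R n\<close> makes the terms of degrees n - 1 and n equal in modulus on the
  unit circle, which puts the transition there.\<close>

private abbreviation (input) "N n z \<equiv> complex_of_real (G n) / (of_real (R n) ^ n * z ^ n)"

lemma mittag_leffler_coeff_pos: "0 < G n"
  using \<rho> by (intro Gamma_real_pos add_pos_nonneg) auto

text \<open>The subtraction is real: for n = 0 the argument is \<open>1 - 1 / \<rho>\<close>,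
  positive because \<rho> > 1. So positivity and monotonicity of the radii hold from index 0
  on.\<close>

lemma radius_arg_pos: "0 < 1 + (real n - 1) / \<rho>"
  using \<rho> by (simp add: field_simps)

lemma radius_scale_pos: "0 < R n"
  unfolding radius_scale_def by (intro divide_pos_pos mittag_leffler_coeff_pos Gamma_real_pos radius_arg_pos)

lemma mittag_leffler_coeff_Suc: "G (Suc n) = R (Suc n) * G n"
  using mittag_leffler_coeff_pos[of n] by (simp add: radius_scale_def)

lemma radius_scale_eq: "R n = Gamma (1 + (real n - 1) / \<rho> + 1 / \<rho>) / Gamma (1 + (real n - 1) / \<rho>)"
  by (simp add: radius_scale_def diff_divide_distrib)

lemma radius_scale_mono: "m \<le> n \<Longrightarrow> R m \<le> R n"
  unfolding radius_scale_eq using \<rho> radius_arg_pos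
  by (intro Gamma_ratio_mono) (auto simp: divide_right_mono)

lemma radius_scale_asymp: "(\<lambda>n. R n / (1 + (real n - 1) / \<rho>) powr (1 / \<rho>)) \<longlonglongrightarrow> 1"
proof -
  have "filterlim (\<lambda>n. 1 + (real n - 1) / \<rho>) at_top sequentially"
    using \<rho> by real_asymp
  from filterlim_compose[OF Gamma_shift_asymp[of "1 / \<rho>"] this]
  show ?thesis using \<rho> by (simp add: radius_scale_eq field_simps)
qed

lemma radius_scale_at_top: "filterlim R at_top sequentially"
proof -
  have "filterlim (\<lambda>n. (1 + (real n - 1) / \<rho>) powr (1 / \<rho>)) at_top sequentially"
    using \<rho> by real_asymp
  from filterlim_tendsto_pos_mult_at_top[OF radius_scale_asymp _ this]
  show ?thesis using less_imp_neq[OF radius_arg_pos] by simp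
qed

text \<open>The radii vary regularly with exponent 1/\<rho>. This gives the limits of the decrements
  at indices proportional to n.\<close>

lemma radius_scale_ratio:
  assumes "0 < \<kappa>" and k: "(\<lambda>n. real (k n) / real n) \<longlonglongrightarrow> \<kappa>"
  shows "(\<lambda>n. R (k n) / R n) \<longlonglongrightarrow> \<kappa> powr (1 / \<rho>)"
proof -
  define x where "x = (\<lambda>n. 1 + (real n - 1) / \<rho>)"
  define g where "g = (\<lambda>n. R n / x n powr (1 / \<rho>))"
  have x_pos: "0 < x n" for n using radius_arg_pos by (simp add: x_def)
  have g: "g \<longlonglongrightarrow> 1" unfolding g_def x_def by (rule radius_scale_asymp)
  have "filterlim (\<lambda>n. real (k n) / real n * real n) at_top sequentially"
    by (rule filterlim_tendsto_pos_mult_at_top[OF k \<open>0 < \<kappa>\<close>]) (rule filterlim_real_sequentially)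
  moreover have "\<forall>\<^sub>F n in sequentially. real (k n) / real n * real n = real (k n)"
    using eventually_gt_at_top[of 0] by eventually_elim auto
  ultimately have "filterlim (\<lambda>n. real (k n)) at_top sequentially"
    by (simp add: filterlim_cong)
  then have k_top: "filterlim k at_top sequentially"
    by (simp add: filterlim_sequentially_iff_filterlim_real)
  have "(\<lambda>n. (real (k n) / real n + (\<rho> - 1) / real n) / (1 + (\<rho> - 1) / real n)) \<longlonglongrightarrow> (\<kappa> + 0) / (1 + 0)"
    by (intro tendsto_intros k real_tendsto_divide_at_top filterlim_real_sequentially) auto
  moreover have "\<forall>\<^sub>F n in sequentially. (real (k n) / real n + (\<rho> - 1) / real n) / (1 + (\<rho> - 1) / real n) = x (k n) / x n"
    using eventually_gt_at_top[of 0]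
  proof eventually_elim
    case (elim n)
    have x_eq: "x m = (real m + (\<rho> - 1)) / \<rho>" for m using \<rho> by (simp add: x_def field_simps)
    have "0 < real n + (\<rho> - 1)" using \<rho> by simp
    then show ?case unfolding x_eq using elim \<rho> by (simp add: divide_simps)
  qed
  ultimately have "(\<lambda>n. x (k n) / x n) \<longlonglongrightarrow> \<kappa>"
    by (simp add: tendsto_cong)
  then have "(\<lambda>n. g (k n) / g n * (x (k n) / x n) powr (1 / \<rho>)) \<longlonglongrightarrow> 1 / 1 * \<kappa> powr (1 / \<rho>)"
    using \<open>0 < \<kappa>\<close> by (intro tendsto_intros g filterlim_compose[OF g k_top]) auto
  moreover have "g (k n) / g n * (x (k n) / x n) powr (1 / \<rho>) = R (k n) / R n" for n
    using x_pos[of n] x_pos[of "k n"] by (simp add: g_def powr_divide less_imp_le)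
  ultimately show ?thesis by simp
qed

text \<open>Consecutive terms have ratio \<open>norm z / R (Suc n)\<close>, which tends to
  0.\<close>

lemma mittag_leffler_summable: "summable (\<lambda>k. z ^ k / of_real (G k) :: complex)"
proof -
  have "\<forall>\<^sub>F n in sequentially. 2 * norm z \<le> R n"
    using radius_scale_at_top by (simp add: filterlim_at_top)
  then obtain N where N: "\<And>n. n \<ge> N \<Longrightarrow> 2 * norm z \<le> R n"
    by (auto simp: eventually_sequentially)
  show ?thesis
  proof (rule summable_ratio_test[where c = "1/2" and N = N])
    fix n assume "n \<ge> N"
    then have "2 * norm z \<le> R (Suc n)" by (intro N) simp
    then have "norm z / R (Suc n) \<le> 1 / 2"
      using radius_scale_pos[of "Suc n"] by (simp add: field_simps)
    then have "norm z / R (Suc n) * (norm z ^ n / G n) \<le> 1 / 2 * (norm z ^ n / G n)"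
      using mittag_leffler_coeff_pos[of n] by (intro mult_right_mono) auto
    moreover have "norm (z ^ k / of_real (G k)) = norm z ^ k / G k" for k
      using mittag_leffler_coeff_pos[of k] by (simp add: norm_divide norm_power)
    moreover have "norm z ^ Suc n / G (Suc n) = norm z / R (Suc n) * (norm z ^ n / G n)"
      unfolding mittag_leffler_coeff_Suc by simp
    ultimately show "norm (z ^ Suc n / of_real (G (Suc n))) \<le> 1 / 2 * norm (z ^ n / of_real (G n))"
      by (simp only:)
  qed simp
qed

lemma mittag_leffler_split: "mittag_leffler \<rho> z = mittag_leffler_section \<rho> n z + mittag_leffler_tail \<rho> (n + 1) z"
proof -
  have "mittag_leffler \<rho> z = (\<Sum>k<n + 1. z ^ k / of_real (G k)) + (\<Sum>k. z ^ (k + (n + 1)) / of_real (G (k + (n + 1))))"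
    using suminf_split_initial_segment[OF mittag_leffler_summable, of z "n + 1"]
    by (simp only: mittag_leffler_def add.commute)
  then show ?thesis
    by (simp add: mittag_leffler_section_def mittag_leffler_tail_def add_ac lessThan_Suc_atMost)
qed

section \<open>Normalized tails and sections as damped geometric series\<close>

text \<open>The two differences are the limits of the decrements of tail and section after about 2
  \<eta> n steps. The bound \<eta> < 1/4 keeps these steps below n, where the section still has
  terms.\<close>

lemma scale_choice:
  assumes "0 < \<epsilon>"
  obtains \<eta> where "0 < \<eta>" "\<eta> < 1 / 4" "1 - 1 / (1 + 2 * \<eta>) powr (1 / \<rho>) < \<epsilon>" "1 - (1 - 2 * \<eta>) powr (1 / \<rho>) < \<epsilon>"
proof -
  have "((\<lambda>\<eta>. 1 - 1 / (1 + 2 * \<eta>) powr (1 / \<rho>)) \<longlongrightarrow> 0) (at_right 0)"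
    using \<rho> by real_asymp
  moreover have "((\<lambda>\<eta>. 1 - (1 - 2 * \<eta>) powr (1 / \<rho>)) \<longlongrightarrow> 0) (at_right 0)"
    using \<rho> by real_asymp
  ultimately have "\<forall>\<^sub>F \<eta> in at_right 0. 1 - 1 / (1 + 2 * \<eta>) powr (1 / \<rho>) < \<epsilon> \<and> 1 - (1 - 2 * \<eta>) powr (1 / \<rho>) < \<epsilon>"
    using assms by (intro eventually_conj order_tendstoD) auto
  moreover have "\<forall>\<^sub>F \<eta> in at_right 0. \<eta> \<in> {0<..<1 / 4 :: real}"
    by (intro eventually_at_right_real) simp
  ultimately have "\<forall>\<^sub>F \<eta> in at_right 0. 1 - 1 / (1 + 2 * \<eta>) powr (1 / \<rho>) < \<epsilon> \<and> 1 - (1 - 2 * \<eta>) powr (1 / \<rho>) < \<epsilon> \<and> \<eta> \<in> {0<..<1 / 4}"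
    by eventually_elim auto
  from eventually_happens'[OF _ this] show ?thesis using that by (auto simp: trivial_limit_at_right_real)
qed

lemma floor_ratio:
  assumes "0 < \<eta>"
  shows "(\<lambda>n. real (nat \<lfloor>\<eta> * real n\<rfloor>) / real n) \<longlonglongrightarrow> \<eta>" "filterlim (\<lambda>n. nat \<lfloor>\<eta> * real n\<rfloor>) at_top sequentially"
  using assms by real_asymp+

text \<open>Consecutive coefficients have ratio \<open>R n / R (Suc (n + k))\<close>, so the
  decrements increase with k because the radii do. After \<eta> n steps they have a positive limit,
  after 2 \<eta> n steps a limit below \<epsilon>/4.\<close>

lemma tail_series:
  assumes "0 < \<epsilon>"
  shows "\<forall>\<^sub>F n in sequentially. \<forall>z::complex. norm z \<le> 1 \<longrightarrow>
    (\<exists>r. (1 - z) * (\<Sum>k. of_real (R n ^ k * G n / G (n + k)) * z ^ k) = 1 + z * r \<and> norm ((1 - z) * r) < \<epsilon>)"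
proof -
  define d where "d = (\<lambda>n k. 1 - R n / R (Suc (n + k)))"
  define a where "a = (\<lambda>n k. R n ^ k * G n / G (n + k))"
  obtain \<eta> where \<eta>: "0 < \<eta>" "1 - 1 / (1 + 2 * \<eta>) powr (1 / \<rho>) < \<epsilon> / 4"
    by (rule scale_choice[of "\<epsilon> / 4"]) (use assms in auto)
  define H where "H = (\<lambda>n. nat \<lfloor>\<eta> * real n\<rfloor>)"
  have H: "(\<lambda>n. real (H n) / real n) \<longlonglongrightarrow> \<eta>" "filterlim H at_top sequentially"
    unfolding H_def by (rule floor_ratio[OF \<eta>(1)])+
  have lim: "(\<lambda>n. d n (c * H n)) \<longlonglongrightarrow> 1 - 1 / (1 + real c * \<eta>) powr (1 / \<rho>)" for c
  proof -
    have pos: "0 < 1 + real c * \<eta>" using \<eta> by (intro add_pos_nonneg) auto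
    have "(\<lambda>n. 1 + real c * (real (H n) / real n) + 1 / real n) \<longlonglongrightarrow> 1 + real c * \<eta> + 0"
      by (intro tendsto_intros H lim_1_over_n)
    moreover have "\<forall>\<^sub>F n in sequentially. 1 + real c * (real (H n) / real n) + 1 / real n = real (Suc (n + c * H n)) / real n"
      using eventually_gt_at_top[of 0] by eventually_elim (auto simp: field_simps)
    ultimately have "(\<lambda>n. real (Suc (n + c * H n)) / real n) \<longlonglongrightarrow> 1 + real c * \<eta>"
      by (simp add: tendsto_cong del: of_nat_Suc)
    from radius_scale_ratio[OF pos this]
    have "(\<lambda>n. 1 - inverse (R (Suc (n + c * H n)) / R n)) \<longlonglongrightarrow> 1 - inverse ((1 + real c * \<eta>) powr (1 / \<rho>))"
      using pos by (intro tendsto_intros) auto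
    then show ?thesis by (simp add: d_def inverse_eq_divide)
  qed
  have d_pos: "0 < 1 - 1 / (1 + real 1 * \<eta>) powr (1 / \<rho>)"
    using \<eta>(1) \<rho> powr_less_mono2[of "1 / \<rho>" 1 "1 + \<eta>"] by simp
  \<comment> \<open>Half of the limit, so that the decrement at \<open>H n\<close> eventually
    exceeds it.\<close>
  define x where "x = (1 - 1 / (1 + real 1 * \<eta>) powr (1 / \<rho>)) / 2"
  have "\<forall>\<^sub>F n in sequentially. \<forall>z::complex. norm z \<le> 1 \<longrightarrow>
    (\<exists>r. (1 - z) * (\<Sum>k. of_real (a n k) * z ^ k) = 1 + z * r \<and> norm ((1 - z) * r) < \<epsilon>)"
  proof (rule damped_geometric_series_uniform[where d = d and H = H and x = x])
    show "a n 0 = 1" for n using mittag_leffler_coeff_pos[of n] by (simp add: a_def)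
    show "a n (Suc k) = a n k * (1 - d n k)" for n k
    proof -
      have *: "G (n + Suc k) = R (Suc (n + k)) * G (n + k)" using mittag_leffler_coeff_Suc[of "n + k"] by simp
      show ?thesis unfolding a_def d_def * by (simp add: mult.commute)
    qed
    show "mono (d n)" for n
      unfolding d_def using radius_scale_pos radius_scale_mono
      by (intro monoI diff_left_mono divide_left_mono mult_pos_pos) (auto simp: less_imp_le)
    show "0 \<le> d n k" for n k
      unfolding d_def using radius_scale_pos[of "Suc (n + k)"] radius_scale_mono[of n "Suc (n + k)"] by simp
    show "d n k \<le> 1" for n k
      unfolding d_def using radius_scale_pos[of n] radius_scale_pos[of "Suc (n + k)"] by simp
    show "summable (a n)" for n
    proof -
      have "summable (\<lambda>k. Re (of_real (R n) ^ k / of_real (G k)))"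
        using mittag_leffler_summable by (rule summable_Re)
      then have "summable (\<lambda>k. R n ^ k / G k)"
        by (simp only: Re_complex_of_real flip: of_real_power of_real_divide)
      then have "summable (\<lambda>k. R n ^ (k + n) / G (k + n) * (G n / R n ^ n))"
        by (intro summable_mult2) (rule summable_ignore_initial_segment)
      moreover have "R n ^ (k + n) / G (k + n) * (G n / R n ^ n) = a n k" for k
        unfolding a_def using radius_scale_pos[of n] by (simp add: power_add add.commute)
      ultimately show ?thesis by simp
    qed
    show "0 < x" using d_pos by (simp add: x_def)
    have "\<forall>\<^sub>F n in sequentially. x < d n (1 * H n)"
      by (rule order_tendstoD[OF lim]) (use d_pos in \<open>simp add: x_def\<close>)
    then show "\<forall>\<^sub>F n in sequentially. x \<le> d n (H n)" by (auto elim: eventually_mono)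
    show "\<forall>\<^sub>F n in sequentially. d n (2 * H n) < \<epsilon> / 4"
      by (rule order_tendstoD[OF lim]) (use \<eta> in simp)
  qed (use H assms in auto)
  then show ?thesis by (simp only: a_def)
qed

lemma section_series:
  assumes "0 < \<epsilon>"
  shows "\<forall>\<^sub>F n in sequentially. \<forall>z::complex. norm z \<le> 1 \<longrightarrow>
    (\<exists>r. (1 - z) * (\<Sum>k\<le>n. of_real (G n / (G (n - k) * R n ^ k)) * z ^ k) = 1 + z * r \<and> norm ((1 - z) * r) < \<epsilon>)"
proof -
  \<comment> \<open>The value 1 from index n on makes \<open>a n (Suc n)\<close> vanish. In this way
    the finite section becomes an infinite series with decrements still increasing.\<close>
  define d where "d = (\<lambda>n k. if k < n then 1 - R (n - k) / R n else 1)"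
  define a where "a = (\<lambda>n k. if k \<le> n then G n / (G (n - k) * R n ^ k) else 0)"
  obtain \<eta> where \<eta>: "0 < \<eta>" "\<eta> < 1 / 4" "1 - (1 - 2 * \<eta>) powr (1 / \<rho>) < \<epsilon> / 4"
    by (rule scale_choice[of "\<epsilon> / 4"]) (use assms in auto)
  define H where "H = (\<lambda>n. nat \<lfloor>\<eta> * real n\<rfloor>)"
  have H: "(\<lambda>n. real (H n) / real n) \<longlonglongrightarrow> \<eta>" "filterlim H at_top sequentially"
    unfolding H_def by (rule floor_ratio[OF \<eta>(1)])+
  have H_less: "2 * H n < n" if "n > 0" for n
  proof -
    have "real (H n) \<le> \<eta> * real n" unfolding H_def using \<eta> by simp
    also have "\<dots> < 1 / 4 * real n" using \<eta> that by (intro mult_strict_right_mono) auto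
    finally show ?thesis by simp
  qed
  have lim: "(\<lambda>n. d n (c * H n)) \<longlonglongrightarrow> 1 - (1 - real c * \<eta>) powr (1 / \<rho>)" if c: "c \<le> 2" for c
  proof -
    have "real c * \<eta> \<le> 2 * \<eta>" using c \<eta> by (intro mult_right_mono) auto
    then have pos: "0 < 1 - real c * \<eta>" using \<eta> by linarith
    have less: "c * H n < n" if "n > 0" for n
      using H_less[OF that] mult_le_mono1[OF c, of "H n"] by linarith
    have "(\<lambda>n. 1 - real c * (real (H n) / real n)) \<longlonglongrightarrow> 1 - real c * \<eta>"
      by (intro tendsto_intros H)
    moreover have "\<forall>\<^sub>F n in sequentially. 1 - real c * (real (H n) / real n) = real (n - c * H n) / real n"
      using eventually_gt_at_top[of 0]
    proof eventually_elim
      case (elim n)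
      then show ?case using less[of n] by (simp add: of_nat_diff field_simps)
    qed
    ultimately have "(\<lambda>n. real (n - c * H n) / real n) \<longlonglongrightarrow> 1 - real c * \<eta>"
      by (simp add: tendsto_cong)
    from radius_scale_ratio[OF pos this]
    have "(\<lambda>n. 1 - R (n - c * H n) / R n) \<longlonglongrightarrow> 1 - (1 - real c * \<eta>) powr (1 / \<rho>)"
      by (intro tendsto_intros)
    moreover have "\<forall>\<^sub>F n in sequentially. 1 - R (n - c * H n) / R n = d n (c * H n)"
      using eventually_gt_at_top[of 0] by eventually_elim (use less in \<open>simp add: d_def\<close>)
    ultimately show ?thesis by (rule Lim_transform_eventually)
  qed
  have d_pos: "0 < 1 - (1 - real 1 * \<eta>) powr (1 / \<rho>)"
    using \<eta> \<rho> powr_less_mono2[of "1 / \<rho>" "1 - \<eta>" 1] by simp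
  define x where "x = (1 - (1 - real 1 * \<eta>) powr (1 / \<rho>)) / 2"
  have "\<forall>\<^sub>F n in sequentially. \<forall>z::complex. norm z \<le> 1 \<longrightarrow>
    (\<exists>r. (1 - z) * (\<Sum>k. of_real (a n k) * z ^ k) = 1 + z * r \<and> norm ((1 - z) * r) < \<epsilon>)"
  proof (rule damped_geometric_series_uniform[where d = d and H = H and x = x])
    show "a n 0 = 1" for n using mittag_leffler_coeff_pos[of n] by (simp add: a_def)
    show "a n (Suc k) = a n k * (1 - d n k)" for n k
    proof (cases "k < n")
      case True
      then have "G (n - k) = R (n - k) * G (n - Suc k)"
        using mittag_leffler_coeff_Suc[of "n - Suc k"] by (simp add: Suc_diff_Suc)
      then show ?thesis
        using True mittag_leffler_coeff_pos[of "n - Suc k"] radius_scale_pos[of n] radius_scale_pos[of "n - k"]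
        by (simp add: a_def d_def)
    qed (auto simp: a_def d_def)
    show "mono (d n)" for n
      unfolding d_def using radius_scale_pos[of n] radius_scale_pos radius_scale_mono
      by (intro monoI) (auto simp: less_imp_le divide_right_mono)
    show "0 \<le> d n k" for n k
      unfolding d_def using radius_scale_pos[of n] radius_scale_mono[of "n - k" n] by simp
    show "d n k \<le> 1" for n k
      unfolding d_def using radius_scale_pos[of n] radius_scale_pos[of "n - k"] by simp
    show "summable (a n)" for n
      by (rule summable_finite[of "{..n}"]) (auto simp: a_def)
    show "0 < x" using d_pos by (simp add: x_def)
    have "\<forall>\<^sub>F n in sequentially. x < d n (1 * H n)"
      by (rule order_tendstoD[OF lim]) (use d_pos in \<open>simp_all add: x_def\<close>)
    then show "\<forall>\<^sub>F n in sequentially. x \<le> d n (H n)" by (auto elim: eventually_mono)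
    show "\<forall>\<^sub>F n in sequentially. d n (2 * H n) < \<epsilon> / 4"
      by (rule order_tendstoD[OF lim]) (use \<eta> in simp_all)
  qed (use H assms in auto)
  moreover have "(\<Sum>k. of_real (a n k) * z ^ k) = (\<Sum>k\<le>n. of_real (G n / (G (n - k) * R n ^ k)) * z ^ k)" for n and z :: complex
  proof -
    have "(\<Sum>k. of_real (a n k) * z ^ k) = (\<Sum>k\<le>n. of_real (a n k) * z ^ k)"
      by (rule suminf_finite) (auto simp: a_def)
    then show ?thesis by (simp add: a_def)
  qed
  ultimately show ?thesis by (simp only:)
qed

section \<open>Relative errors of tail and section\<close>

text \<open>The asymptotic formula solved for its error: the expansion then holds identically for z
  other than 0 and 1, and only smallness remains to be proved. The same device serves for the other
  errors.\<close>

definition tail_error :: "nat \<Rightarrow> complex \<Rightarrow> complex" where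
  "tail_error n z = mittag_leffler_tail \<rho> (n + 1) (of_real (R n) * z) * N n z * ((1 - z) / z) - 1"

definition section_error :: "nat \<Rightarrow> complex \<Rightarrow> complex" where
  "section_error n z = - mittag_leffler_section \<rho> n (of_real (R n) * z) * N n z * ((1 - z) / z) - 1"

lemma tail_error_eq:
  "z \<noteq> 0 \<Longrightarrow> z \<noteq> 1 \<Longrightarrow> mittag_leffler_tail \<rho> (n + 1) (of_real (R n) * z) * N n z = z / (1 - z) * (1 + tail_error n z)"
  by (simp add: tail_error_def)

lemma section_error_eq:
  "z \<noteq> 0 \<Longrightarrow> z \<noteq> 1 \<Longrightarrow> mittag_leffler_section \<rho> n (of_real (R n) * z) * N n z = - (z / (1 - z)) * (1 + section_error n z)"
  by (simp add: section_error_def)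

lemma normalized_comb_tail:
  "normalized_comb \<rho> n l z = (1 - l) * (mittag_leffler \<rho> (of_real (R n) * z) * N n z)
     - mittag_leffler_tail \<rho> (n + 1) (of_real (R n) * z) * N n z"
  unfolding normalized_comb_def section_tail_comb_def mittag_leffler_split[of _ n]
  by (simp add: algebra_simps diff_divide_distrib add_divide_distrib)

lemma normalized_comb_section:
  "normalized_comb \<rho> n l z = mittag_leffler_section \<rho> n (of_real (R n) * z) * N n z
     - l * (mittag_leffler \<rho> (of_real (R n) * z) * N n z)"
  unfolding normalized_comb_def section_tail_comb_def mittag_leffler_split[of _ n]
  by (simp add: algebra_simps diff_divide_distrib add_divide_distrib)

text \<open>The series of \<open>tail_series\<close> starts at degree n, the tail at degree n + 1.
  Removing the constant term 1 turns \<open>1 + z * r\<close> into \<open>z * (1 + r)\<close>, so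
  the error is exactly \<open>r\<close>.\<close>

lemma tail_error_small:
  assumes "0 < \<epsilon>"
  shows "\<forall>\<^sub>F n in sequentially. \<forall>z. z \<noteq> 0 \<longrightarrow> norm z \<le> 1 \<longrightarrow> norm ((1 - z) * tail_error n z) < \<epsilon>"
  using tail_series[OF assms]
proof eventually_elim
  case (elim n)
  show ?case
  proof (intro allI impI)
    fix z :: complex assume z: "z \<noteq> 0" "norm z \<le> 1"
    define a where "a = (\<lambda>k. R n ^ k * G n / G (n + k))"
    obtain r where r: "(1 - z) * (\<Sum>k. of_real (a k) * z ^ k) = 1 + z * r" "norm ((1 - z) * r) < \<epsilon>"
      using elim z unfolding a_def by blast
    have term_eq: "(of_real (R n) * z) ^ (n + k) / of_real (G (n + k)) * N n z = of_real (a k) * z ^ k" for k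
      using z radius_scale_pos[of n] by (simp add: a_def power_add power_mult_distrib)
    have sum: "summable (\<lambda>k. (of_real (R n) * z) ^ (n + k) / of_real (G (n + k)))"
      using summable_ignore_initial_segment[OF mittag_leffler_summable[of "of_real (R n) * z"], of n]
      by (simp only: add.commute[of n])
    have "(\<lambda>k. of_real (a k) * z ^ k) sums ((\<Sum>k. (of_real (R n) * z) ^ (n + k) / of_real (G (n + k))) * N n z)"
      using sums_mult2[OF summable_sums[OF sum], of "N n z"] unfolding term_eq .
    then have sum_a: "summable (\<lambda>k. of_real (a k) * z ^ k)" by (rule sums_summable)
    have "(\<Sum>k. of_real (a k) * z ^ k) = of_real (a 0) + (\<Sum>k. of_real (a (Suc k)) * z ^ Suc k)"
      using suminf_split_head[OF sum_a] by simp
    also have "a 0 = 1" using mittag_leffler_coeff_pos[of n] by (simp add: a_def)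
    also have "(\<Sum>k. of_real (a (Suc k)) * z ^ Suc k) = mittag_leffler_tail \<rho> (n + 1) (of_real (R n) * z) * N n z"
    proof -
      have "summable (\<lambda>k. (of_real (R n) * z) ^ (n + 1 + k) / of_real (G (n + 1 + k)))"
        using summable_ignore_initial_segment[OF mittag_leffler_summable[of "of_real (R n) * z"], of "n + 1"]
        by (simp only: add.commute[of "n + 1"])
      from suminf_mult2[OF this, of "N n z"]
      have "mittag_leffler_tail \<rho> (n + 1) (of_real (R n) * z) * N n z
        = (\<Sum>k. (of_real (R n) * z) ^ (n + 1 + k) / of_real (G (n + 1 + k)) * N n z)"
        by (simp only: mittag_leffler_tail_def)
      also have "(\<lambda>k. (of_real (R n) * z) ^ (n + 1 + k) / of_real (G (n + 1 + k)) * N n z) = (\<lambda>k. of_real (a (Suc k)) * z ^ Suc k)"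
        using term_eq[of "Suc _"] by (intro ext) (simp only: add_Suc_right add_Suc Suc_eq_plus1[symmetric])
      finally show ?thesis ..
    qed
    finally have P: "mittag_leffler_tail \<rho> (n + 1) (of_real (R n) * z) * N n z = (\<Sum>k. of_real (a k) * z ^ k) - 1"
      by simp
    have "(1 - z) * ((\<Sum>k. of_real (a k) * z ^ k) - 1) = z * (1 + r)"
      using r(1) by (simp add: algebra_simps)
    then have "tail_error n z = r"
      using z unfolding tail_error_def P by (simp add: divide_simps mult.commute)
    with r show "norm ((1 - z) * tail_error n z) < \<epsilon>" by simp
  qed
qed

text \<open>Read downwards from degree n, the normalized section is a series in 1/z. Since -z/(1 -
  z) = 1/(1 - 1/z), its error is \<open>r / z\<close>, no larger than \<open>r\<close> for
  \<open>norm z \<ge> 1\<close>.\<close>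

lemma section_error_small:
  assumes "0 < \<epsilon>"
  shows "\<forall>\<^sub>F n in sequentially. \<forall>z. 1 \<le> norm z \<longrightarrow> norm ((1 - 1 / z) * section_error n z) < \<epsilon>"
  using section_series[OF assms]
proof eventually_elim
  case (elim n)
  show ?case
  proof (intro allI impI)
    fix z :: complex assume z: "1 \<le> norm z"
    then have "z \<noteq> 0" by auto
    define a where "a = (\<lambda>k. G n / (G (n - k) * R n ^ k))"
    have "norm (1 / z) \<le> 1" using z by (simp add: norm_divide divide_le_eq)
    then obtain r where r: "(1 - 1 / z) * (\<Sum>k\<le>n. of_real (a k) * (1 / z) ^ k) = 1 + 1 / z * r" "norm ((1 - 1 / z) * r) < \<epsilon>"
      using elim unfolding a_def by blast
    have term_eq: "(of_real (R n) * z) ^ (n - k) / of_real (G (n - k)) * N n z = of_real (a k) * (1 / z) ^ k" if "k \<le> n" for k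
    proof -
      have "x ^ (n - k) / x ^ n = 1 / x ^ k" if "x \<noteq> 0" for x :: complex
        using that \<open>k \<le> n\<close> by (simp add: power_diff)
      then have powers: "z ^ (n - k) / z ^ n = 1 / z ^ k"
        "complex_of_real (R n) ^ (n - k) / of_real (R n) ^ n = 1 / of_real (R n) ^ k"
        using \<open>z \<noteq> 0\<close> radius_scale_pos[of n] by auto
      have "(of_real (R n) * z) ^ (n - k) / of_real (G (n - k)) * N n z
        = of_real (G n) / of_real (G (n - k)) * (of_real (R n) ^ (n - k) / of_real (R n) ^ n) * (z ^ (n - k) / z ^ n)"
        by (simp add: power_mult_distrib mult_ac)
      then show ?thesis unfolding powers by (simp add: a_def power_one_over)
    qed
    have "mittag_leffler_section \<rho> n (of_real (R n) * z) * N n z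
      = (\<Sum>k\<le>n. (of_real (R n) * z) ^ (n - k) / of_real (G (n - k)) * N n z)"
      unfolding mittag_leffler_section_def sum_distrib_right
      by (rule sum.reindex_bij_witness[where i = "\<lambda>k. n - k" and j = "\<lambda>k. n - k"]) auto
    also have "\<dots> = (\<Sum>k\<le>n. of_real (a k) * (1 / z) ^ k)"
      by (intro sum.cong term_eq) auto
    finally have "section_error n z = (1 - 1 / z) * (\<Sum>k\<le>n. of_real (a k) * (1 / z) ^ k) - 1"
      unfolding section_error_def using \<open>z \<noteq> 0\<close> by (simp add: field_simps)
    also have "\<dots> = 1 / z * r" using r(1) by simp
    finally have "norm ((1 - 1 / z) * section_error n z) = norm (1 / z) * norm ((1 - 1 / z) * r)"
      by (simp only: norm_mult mult_ac)
    also have "\<dots> \<le> norm ((1 - 1 / z) * r)"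
      using \<open>norm (1 / z) \<le> 1\<close> by (intro mult_left_le_one_le) auto
    finally show "norm ((1 - 1 / z) * section_error n z) < \<epsilon>" using r(2) by simp
  qed
qed

lemma tail_error_uniform:
  assumes "0 < c" "\<And>z. z \<in> S \<Longrightarrow> z \<noteq> 0 \<and> norm z \<le> 1 \<and> c \<le> norm (1 - z)"
  shows "uniform_limit S tail_error (\<lambda>_. 0) sequentially"
proof (rule uniform_limit_mult_bounded_below[OF assms(1)])
  fix \<epsilon> :: real assume "0 < \<epsilon>"
  then show "\<forall>\<^sub>F n in sequentially. \<forall>z\<in>S. norm ((1 - z) * tail_error n z) < \<epsilon>"
    by (rule eventually_mono[OF tail_error_small]) (use assms in auto)
qed (use assms in auto)

lemma section_error_uniform:
  assumes "0 < c" "\<And>z. z \<in> S \<Longrightarrow> 1 \<le> norm z \<and> c \<le> norm (1 - 1 / z)"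
  shows "uniform_limit S section_error (\<lambda>_. 0) sequentially"
proof (rule uniform_limit_mult_bounded_below[OF assms(1)])
  fix \<epsilon> :: real assume "0 < \<epsilon>"
  then show "\<forall>\<^sub>F n in sequentially. \<forall>z\<in>S. norm ((1 - 1 / z) * section_error n z) < \<epsilon>"
    by (rule eventually_mono[OF section_error_small]) (use assms in auto)
qed (use assms in auto)

section \<open>The exponential sector\<close>

definition exp_error :: "nat \<Rightarrow> complex \<Rightarrow> complex" where
  "exp_error n z = mittag_leffler \<rho> (of_real (R n) * z)
     / (of_real \<rho> * exp (of_real (R n powr \<rho>) * z powr of_real \<rho>)) - 1"

lemma exp_error_eq:
  "mittag_leffler \<rho> (of_real (R n) * z) * N n z = of_real \<rho> * exponential_term \<rho> n z * (1 + exp_error n z)"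
  using \<rho> by (simp add: exp_error_def exponential_term_def)

text \<open>In the closed sector the real part of \<open>z powr \<rho>\<close> is nonnegative, so
  the main term has modulus at least \<rho> > 1 and dividing by it does not enlarge the absolute
  error.\<close>

lemma exp_error_bound:
  assumes "z \<noteq> 0" "\<bar>Arg z\<bar> \<le> pi / (2 * \<rho>)"
  shows "norm (exp_error n z) \<le> Gamma (1 / \<rho>) / sin (pi / (2 * \<rho>)) / (R n * norm z)"
proof -
  define w where "w = of_real (R n) * z"
  have w: "w \<noteq> 0" "Arg w = Arg z" "norm w = R n * norm z"
    using assms radius_scale_pos[of n] by (auto simp: w_def norm_mult Arg_times_of_real)
  have powr_eq: "w powr of_real \<rho> = of_real (R n powr \<rho>) * z powr of_real \<rho>"
    using radius_scale_pos[of n] by (simp add: w_def powr_times_real_left powr_of_real)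
  define D where "D = of_real \<rho> * exp (w powr of_real \<rho>)"
  have "\<rho> * \<bar>Arg z\<bar> \<le> \<rho> * (pi / (2 * \<rho>))" using assms \<rho> by (intro mult_left_mono) auto
  then have "\<bar>\<rho> * Arg z\<bar> \<le> pi / 2" using \<rho> by (simp add: abs_mult)
  then have "0 \<le> cos (\<rho> * Arg z)" by (intro cos_ge_zero) auto
  then have "0 \<le> Re (w powr of_real \<rho>)"
    using w by (simp add: powr_def Re_exp Arg_eq_Im_Ln[symmetric])
  then have "1 * 1 \<le> \<rho> * exp (Re (w powr of_real \<rho>))"
    using \<rho> by (intro mult_mono) auto
  then have D: "1 \<le> norm D" using \<rho> by (simp add: D_def norm_mult)
  then have "D \<noteq> 0" by auto
  then have "exp_error n z = (mittag_leffler \<rho> w - D) / D"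
    unfolding exp_error_def powr_eq[symmetric] w_def[symmetric] D_def[symmetric] by (simp add: diff_divide_distrib)
  then have "norm (exp_error n z) = norm (mittag_leffler \<rho> w - D) / norm D"
    by (simp add: norm_divide)
  also have "\<dots> \<le> norm (mittag_leffler \<rho> w - D) / 1"
    using D by (intro divide_left_mono) auto
  also have "\<dots> \<le> Gamma (1 / \<rho>) / sin (pi / (2 * \<rho>)) / (R n * norm z)"
    using mittag_leffler_exp_asymp[of \<rho> w] \<rho> w assms by (simp add: D_def)
  finally show ?thesis .
qed

lemma uniformly_small_of_inverse_bound:
  assumes "\<And>n z. z \<in> S \<Longrightarrow> norm (e n z) \<le> C / (R n * norm z)"
  shows "uniformly_small_off_origin R S e"
  unfolding uniformly_small_off_origin_def
proof (intro allI impI)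
  fix \<epsilon> :: real assume \<epsilon>: "0 < \<epsilon>"
  \<comment> \<open>The threshold is independent of n; the summand 1 gives positivity and strict
    inequality.\<close>
  define M where "M = \<bar>C\<bar> / \<epsilon> + 1"
  have M: "0 < M" using \<epsilon> by (auto simp: M_def intro: add_nonneg_pos)
  have "norm (e n z) < \<epsilon>" if z: "z \<in> S" and large: "M \<le> R n * norm z" for n z
  proof -
    have "norm (e n z) \<le> C / (R n * norm z)" by (rule assms[OF z])
    also have "\<dots> \<le> \<bar>C\<bar> / (R n * norm z)"
      using radius_scale_pos[of n] by (intro divide_right_mono) auto
    also have "\<dots> \<le> \<bar>C\<bar> / M"
      using large M by (intro divide_left_mono) auto
    also have "\<dots> < \<epsilon>" using \<epsilon> M by (simp add: M_def field_simps)
    finally show ?thesis .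
  qed
  then show "\<exists>M. \<forall>\<^sub>F n in sequentially. \<forall>z\<in>S. M \<le> R n * norm z \<longrightarrow> norm (e n z) < \<epsilon>"
    by (intro exI[of _ M] always_eventually) auto
qed

text \<open>Here \<open>R n * norm z \<ge> R n\<close>, so the bound on \<open>exp_error\<close>
  becomes plainly uniform. The section form is used, whence the coefficient -l.\<close>

lemma normalized_comb_sector_exterior:
  assumes "0 < \<delta>"
  defines "S \<equiv> {z. 1 \<le> norm z \<and> \<bar>Arg z\<bar> \<le> pi / (2 * \<rho>) \<and> \<delta> \<le> norm (z - 1)}"
  shows "\<exists>e1 e2. uniform_limit S e1 (\<lambda>_. 0) sequentially \<and> uniform_limit S e2 (\<lambda>_. 0) sequentially \<and>
     (\<forall>n\<ge>1. \<forall>z\<in>S. normalized_comb \<rho> n l z =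
        - l * of_real \<rho> * exponential_term \<rho> n z * (1 + e1 n z) - z / (1 - z) * (1 + e2 n z))"
proof (rule exI[of _ exp_error], rule exI[of _ section_error], intro conjI allI ballI impI)
  show "uniform_limit S section_error (\<lambda>_. 0) sequentially"
    by (rule section_error_uniform[of "min (1 / 2) (\<delta> / 2)"])
      (use assms norm_one_minus_inverse_ge in \<open>auto simp: S_def\<close>)
  define C where "C = Gamma (1 / \<rho>) / sin (pi / (2 * \<rho>))"
  have lim: "(\<lambda>n. \<bar>C\<bar> / R n) \<longlonglongrightarrow> 0"
    by (intro real_tendsto_divide_at_top[OF tendsto_const] radius_scale_at_top)
  show "uniform_limit S exp_error (\<lambda>_. 0) sequentially"
  proof (rule uniform_limitI)
    fix \<epsilon> :: real assume "0 < \<epsilon>"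
    then have "\<forall>\<^sub>F n in sequentially. \<bar>C\<bar> / R n < \<epsilon>"
      by (rule order_tendstoD[OF lim])
    then show "\<forall>\<^sub>F n in sequentially. \<forall>z\<in>S. dist (exp_error n z) 0 < \<epsilon>"
    proof eventually_elim
      case (elim n)
      show ?case
      proof
        fix z assume z: "z \<in> S"
        then have "1 \<le> norm z" "z \<noteq> 0" by (auto simp: S_def)
        have "norm (exp_error n z) \<le> C / (R n * norm z)"
          unfolding C_def using z \<open>z \<noteq> 0\<close> by (intro exp_error_bound) (auto simp: S_def)
        also have "\<dots> \<le> \<bar>C\<bar> / (R n * 1)"
          using \<open>1 \<le> norm z\<close> radius_scale_pos[of n] by (intro frac_le mult_left_mono) auto
        also have "\<dots> < \<epsilon>" using elim by simp
        finally show "dist (exp_error n z) 0 < \<epsilon>" by simp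
      qed
    qed
  qed
  fix n z assume "z \<in> S"
  then have "z \<noteq> 0" "z \<noteq> 1" using assms by (auto simp: S_def)
  then show "normalized_comb \<rho> n l z = - l * of_real \<rho> * exponential_term \<rho> n z * (1 + exp_error n z)
      - z / (1 - z) * (1 + section_error n z)"
    unfolding normalized_comb_section section_error_eq[OF \<open>z \<noteq> 0\<close> \<open>z \<noteq> 1\<close>] exp_error_eq
    by (simp only: mult_minus_left minus_diff_commute mult.assoc)
qed

text \<open>The tail form, whence the coefficient 1 - l. The set reaches the origin, so the first
  error is small only for large \<open>R n * norm z\<close>, whereas the tail error is uniform on
  the whole set.\<close>

lemma normalized_comb_sector_interior:
  assumes "0 < \<delta>"
  defines "S \<equiv> {z. 0 < norm z \<and> norm z \<le> 1 \<and> \<bar>Arg z\<bar> \<le> pi / (2 * \<rho>) \<and> \<delta> \<le> norm (z - 1)}"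
  shows "\<exists>e1 e2. uniformly_small_off_origin R S e1 \<and> uniform_limit S e2 (\<lambda>_. 0) sequentially \<and>
     (\<forall>n\<ge>1. \<forall>z\<in>S. normalized_comb \<rho> n l z =
        (1 - l) * of_real \<rho> * exponential_term \<rho> n z * (1 + e1 n z) - z / (1 - z) * (1 + e2 n z))"
proof (rule exI[of _ exp_error], rule exI[of _ tail_error], intro conjI allI ballI impI)
  have S: "z \<noteq> 0 \<and> norm z \<le> 1 \<and> \<bar>Arg z\<bar> \<le> pi / (2 * \<rho>) \<and> \<delta> \<le> norm (1 - z)" if "z \<in> S" for z
    using that unfolding S_def mem_Collect_eq zero_less_norm_iff norm_minus_commute[of z 1] by blast
  show "uniform_limit S tail_error (\<lambda>_. 0) sequentially"
    by (rule tail_error_uniform[OF \<open>0 < \<delta>\<close>]) (use S in blast)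
  show "uniformly_small_off_origin R S exp_error"
  proof (rule uniformly_small_of_inverse_bound)
    show "norm (exp_error n z) \<le> Gamma (1 / \<rho>) / sin (pi / (2 * \<rho>)) / (R n * norm z)" if "z \<in> S" for n z
      by (rule exp_error_bound) (use S[OF that] in blast)+
  qed
  fix n z assume "z \<in> S"
  then have "z \<noteq> 0" "\<delta> \<le> norm (1 - z)" using S by blast+
  then have "z \<noteq> 1" using \<open>0 < \<delta>\<close> by auto
  show "normalized_comb \<rho> n l z = (1 - l) * of_real \<rho> * exponential_term \<rho> n z * (1 + exp_error n z)
      - z / (1 - z) * (1 + tail_error n z)"
    unfolding normalized_comb_tail tail_error_eq[OF \<open>z \<noteq> 0\<close> \<open>z \<noteq> 1\<close>] exp_error_eq
    by (simp only: mult.assoc)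
qed

section \<open>The complementary sector\<close>

text \<open>The left side is the product of the increasing radii \<open>R 1\<close>, ...,
  \<open>R n\<close>. The bound shows that the leading term is at most \<open>1 / R n\<close>
  outside the unit disc.\<close>

lemma coeff_le_radius_power: "G n \<le> R n ^ n"
proof -
  have "G k \<le> R n ^ k" if "k \<le> n" for k
    using that
  proof (induction k)
    case 0
    then show ?case by simp
  next
    case (Suc k)
    have "R (Suc k) * G k \<le> R n * R n ^ k"
    proof (rule mult_mono)
      show "R (Suc k) \<le> R n" using Suc.prems by (rule radius_scale_mono)
      show "G k \<le> R n ^ k" using Suc by simp
      show "0 \<le> R n" using radius_scale_pos[of n] by (rule less_imp_le)
      show "0 \<le> G k" using mittag_leffler_coeff_pos[of k] by (rule less_imp_le)
    qed
    then show ?case by (simp only: mittag_leffler_coeff_Suc power_Suc)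
  qed
  then show ?thesis by simp
qed

lemma normalized_comb_off_sector:
  assumes \<delta>: "0 < \<delta>"
  defines "S \<equiv> {z. 0 < norm z \<and> pi / (2 * \<rho>) + \<delta> \<le> \<bar>Arg z\<bar>}"
  shows "\<exists>e1 e2. uniformly_small_off_origin R S e1 \<and> uniform_limit S e2 (\<lambda>_. 0) sequentially \<and>
     (\<forall>n\<ge>1. \<forall>z\<in>S. normalized_comb \<rho> n l z =
        (l - 1) / of_real (Gamma (1 - 1 / \<rho>))
          * (of_real (G n) / (of_real (R n) ^ (n + 1) * z ^ (n + 1)))
          * (1 + e1 n z) - z / (1 - z) * (1 + e2 n z))"
proof -
  define \<gamma> where "\<gamma> = Gamma (1 - 1 / \<rho>)"
  have \<gamma>: "0 < \<gamma>" "rGamma (1 - 1 / \<rho>) = 1 / \<gamma>"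
    using \<rho> by (auto simp: \<gamma>_def rGamma_inverse_Gamma inverse_eq_divide)
  obtain C where C: "0 \<le> C" and asymp: "\<And>z. z \<noteq> 0 \<Longrightarrow> pi / (2 * \<rho>) + \<delta> \<le> \<bar>Arg z\<bar> \<Longrightarrow>
    norm (mittag_leffler \<rho> z + of_real (rGamma (1 - 1 / \<rho>)) / z) \<le> C / (norm z)\<^sup>2"
    by (rule mittag_leffler_inverse_asymp[OF \<rho> \<delta>], rule that)
  define w where "w = (\<lambda>n z. of_real (R n) * z :: complex)"
  have w: "w n z \<noteq> 0" "norm (w n z) = R n * norm z" "Arg (w n z) = Arg z" if "z \<in> S" for n z
    using that radius_scale_pos[of n] by (auto simp: S_def w_def norm_mult Arg_times_of_real)
  define \<epsilon>0 where "\<epsilon>0 = (\<lambda>n z. - of_real \<gamma> * w n z * mittag_leffler \<rho> (w n z) - 1)"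
  have ml_eq: "mittag_leffler \<rho> (w n z) = - ((1 + \<epsilon>0 n z) / (of_real \<gamma> * w n z))" if "z \<in> S" for n z
    using \<gamma> w(1)[OF that, of n] by (simp add: \<epsilon>0_def)
  have \<epsilon>0_bound: "norm (\<epsilon>0 n z) \<le> \<gamma> * C / (R n * norm z)" if z: "z \<in> S" for n z
  proof -
    have "\<epsilon>0 n z = - of_real \<gamma> * w n z * (mittag_leffler \<rho> (w n z) + of_real (1 / \<gamma>) / w n z)"
      using \<gamma> w(1)[OF z, of n] by (simp add: \<epsilon>0_def field_simps)
    then have "norm (\<epsilon>0 n z) = \<gamma> * norm (w n z) * norm (mittag_leffler \<rho> (w n z) + of_real (1 / \<gamma>) / w n z)"
      using \<gamma> by (simp add: norm_mult)
    also have "\<dots> \<le> \<gamma> * norm (w n z) * (C / (norm (w n z))\<^sup>2)"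
    proof (rule mult_left_mono)
      show "norm (mittag_leffler \<rho> (w n z) + of_real (1 / \<gamma>) / w n z) \<le> C / (norm (w n z))\<^sup>2"
        using asymp[of "w n z"] w[OF z, of n] z \<gamma> by (simp add: S_def)
    qed (use \<gamma> in simp)
    also have "\<dots> = \<gamma> * C / norm (w n z)"
      using w(1)[OF z, of n] by (simp add: power2_eq_square)
    finally show ?thesis using w[OF z] by simp
  qed
  \<comment> \<open>Outside the disc the leading term is kept exactly as claimed, with error 0, and
    everything that does not fit is moved to \<open>e2\<close>.\<close>
  define e1 where "e1 = (\<lambda>n z. if norm z \<le> 1 then \<epsilon>0 n z else 0)"
  define X where "X = (\<lambda>n z. complex_of_real (G n) / (of_real (R n) ^ (n + 1) * z ^ (n + 1)))"
  \<comment> \<open>The difference between the claimed leading term and the one from the section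
    form, divided by z/(1 - z) so that it can be added to \<open>section_error\<close>.\<close>
  define h where "h = (\<lambda>n z. (1 - z) / z * (X n z * ((l - 1) / of_real \<gamma> - l / of_real \<gamma> * (1 + \<epsilon>0 n z))))"
  define e2 where "e2 = (\<lambda>n z. if norm z \<le> 1 then tail_error n z else section_error n z + h n z)"
  have ml_N: "mittag_leffler \<rho> (of_real (R n) * z) * N n z = - (X n z / of_real \<gamma> * (1 + \<epsilon>0 n z))" if z: "z \<in> S" for n z
    using ml_eq[OF z, of n] by (simp add: w_def X_def mult_ac)
  have e1: "uniformly_small_off_origin R S e1"
    by (rule uniformly_small_of_inverse_bound[where C = "\<gamma> * C"])
      (use \<epsilon>0_bound \<gamma> C radius_scale_pos in \<open>auto simp: e1_def less_imp_le\<close>)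
  \<comment> \<open>An angle that all of \<open>S\<close> keeps from the positive real axis. It
    yields the distance to 1 which in the other two cases is assumed.\<close>
  define \<eta> where "\<eta> = min (pi / (2 * \<rho>)) (pi / 2)"
  have \<eta>: "0 < \<eta>" "\<eta> \<le> pi / 2" using \<rho> by (auto simp: \<eta>_def)
  have "0 < sin \<eta>" using \<eta> by (intro sin_gt_zero) auto
  have away: "sin \<eta> \<le> norm (1 - z)" "sin \<eta> \<le> norm (1 - 1 / z)" if z: "z \<in> S" for z
  proof -
    have "\<eta> \<le> \<bar>Arg z\<bar>" using z \<delta> by (auto simp: S_def \<eta>_def)
    then have cos: "cos (Arg z) \<le> cos \<eta>" "cos (- Arg z) \<le> cos \<eta>"
      using \<eta> Arg_bounded[of z] cos_le_cos_gap[of \<eta> "Arg z"] by (auto simp: abs_le_iff)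
    show "sin \<eta> \<le> norm (1 - z)"
      using sin_le_norm_one_minus_rcis[OF norm_ge_zero cos(1), of z] by (simp add: rcis_cmod_Arg)
    have "1 / z = rcis (1 / norm z) (- Arg z)"
      by (metis rcis_cmod_Arg rcis_inverse inverse_eq_divide)
    then show "sin \<eta> \<le> norm (1 - 1 / z)"
      using sin_le_norm_one_minus_rcis[OF _ cos(2), of "1 / norm z"] by simp
  qed
  have tail: "uniform_limit {z\<in>S. norm z \<le> 1} tail_error (\<lambda>_. 0) sequentially"
    by (rule tail_error_uniform[OF \<open>0 < sin \<eta>\<close>]) (use away in \<open>auto simp: S_def\<close>)
  have sect: "uniform_limit {z\<in>S. 1 < norm z} section_error (\<lambda>_. 0) sequentially"
    by (rule section_error_uniform[OF \<open>0 < sin \<eta>\<close>]) (use away in auto)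
  \<comment> \<open>The factor 2 bounds \<open>norm ((1 - z) / z)\<close> outside the disc, and
    \<gamma> C bounds \<open>norm (\<epsilon>0 n z)\<close> there once
    \<open>R n \<ge> 1\<close>.\<close>
  define K where "K = 2 * (norm ((l - 1) / of_real \<gamma>) + norm (l / of_real \<gamma>) * (1 + \<gamma> * C))"
  have h_bound: "norm (h n z) \<le> K / R n" if z: "z \<in> S" "1 < norm z" and R: "1 \<le> R n" for n z
  proof -
    have "norm ((1 - z) / z) \<le> 2"
      using norm_triangle_ineq4[of 1 z] z(2) by (simp add: norm_divide divide_le_eq)
    moreover have "norm (X n z) \<le> 1 / R n"
    proof -
      have "norm (X n z) = G n / (R n ^ n * (R n * norm z ^ (n + 1)))"
        using radius_scale_pos[of n] mittag_leffler_coeff_pos[of n] by (simp add: X_def norm_divide norm_mult norm_power mult_ac)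
      also have "\<dots> \<le> R n ^ n / (R n ^ n * (R n * 1))"
        using coeff_le_radius_power[of n] radius_scale_pos[of n] one_le_power[of "norm z" "n + 1"] z(2)
        by (intro frac_le mult_left_mono) (auto simp: less_imp_le)
      finally show ?thesis using radius_scale_pos[of n] by simp
    qed
    moreover have "norm ((l - 1) / of_real \<gamma> - l / of_real \<gamma> * (1 + \<epsilon>0 n z)) \<le> K / 2"
    proof -
      have "norm (1 + \<epsilon>0 n z) \<le> 1 + \<gamma> * C / (R n * norm z)"
        using norm_triangle_ineq[of 1 "\<epsilon>0 n z"] \<epsilon>0_bound[OF z(1), of n] by simp
      also have "\<dots> \<le> 1 + \<gamma> * C / (1 * 1)"
        using R z(2) \<gamma> C by (intro add_left_mono divide_left_mono mult_mono mult_pos_pos) auto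
      finally have "norm (l / of_real \<gamma>) * norm (1 + \<epsilon>0 n z) \<le> norm (l / of_real \<gamma>) * (1 + \<gamma> * C)"
        by (intro mult_left_mono) auto
      then show ?thesis
        using norm_triangle_ineq4[of "(l - 1) / of_real \<gamma>" "l / of_real \<gamma> * (1 + \<epsilon>0 n z)"]
        unfolding norm_mult K_def by simp
    qed
    ultimately have "norm (h n z) \<le> 2 * (1 / R n * (K / 2))"
      unfolding h_def norm_mult using radius_scale_pos[of n] by (intro mult_mono) auto
    then show ?thesis by simp
  qed
  have "(\<lambda>n. K / R n) \<longlonglongrightarrow> 0"
    by (intro real_tendsto_divide_at_top[OF tendsto_const] radius_scale_at_top)
  have e2: "uniform_limit S e2 (\<lambda>_. 0) sequentially"
  proof (rule uniform_limitI)
    fix \<epsilon> :: real assume \<epsilon>: "0 < \<epsilon>"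
    have "\<forall>\<^sub>F n in sequentially. K / R n < \<epsilon> / 2"
      using \<open>(\<lambda>n. K / R n) \<longlonglongrightarrow> 0\<close> \<epsilon> by (intro order_tendstoD) auto
    moreover have "\<forall>\<^sub>F n in sequentially. 1 \<le> R n"
      using radius_scale_at_top by (simp add: filterlim_at_top)
    ultimately show "\<forall>\<^sub>F n in sequentially. \<forall>z\<in>S. dist (e2 n z) 0 < \<epsilon>"
      using uniform_limitD[OF tail \<epsilon>] uniform_limitD[OF sect half_gt_zero[OF \<epsilon>]]
    proof eventually_elim
      case (elim n)
      show ?case
      proof
        fix z assume z: "z \<in> S"
        show "dist (e2 n z) 0 < \<epsilon>"
        proof (cases "norm z \<le> 1")
          case True
          then show ?thesis using elim z by (simp add: e2_def)
        next
          case False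
          then have "norm (section_error n z) < \<epsilon> / 2" using elim z by auto
          moreover have "norm (h n z) < \<epsilon> / 2"
            by (rule order_le_less_trans[OF h_bound]) (use elim z False in auto)
          ultimately show ?thesis
            using False norm_triangle_ineq[of "section_error n z" "h n z"] by (simp add: e2_def)
        qed
      qed
    qed
  qed
  have rearrange: "- q * (1 + s) - l * (- (x / c * t)) = p * x * (1 + 0) - q * (1 + (s + y))"
    if "q * y = x * (p - l / c * t)" for c p q s t x y :: complex
  proof -
    have 1: "q * (1 + (s + y)) = q * (1 + s) + q * y" by (simp only: distrib_left add.assoc)
    have 2: "x * (p - l / c * t) = p * x - l * (x / c * t)"
      by (simp add: right_diff_distrib mult.commute)
    show ?thesis unfolding 1 that 2 by simp
  qed
  have sign: "(1 - l) * (- (x / c * t)) = (l - 1) / c * x * t" for c t x :: complex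
  proof -
    have "1 - l = - (l - 1)" by simp
    then show ?thesis by (simp only: minus_mult_minus) simp
  qed
  have "normalized_comb \<rho> n l z = (l - 1) / of_real \<gamma> * X n z * (1 + e1 n z) - z / (1 - z) * (1 + e2 n z)"
    if z: "z \<in> S" for n z
  proof -
    have nz: "z \<noteq> 0" "z \<noteq> 1" using away[OF z] \<open>0 < sin \<eta>\<close> z by (auto simp: S_def)
    show ?thesis
    proof (cases "norm z \<le> 1")
      case True
      then show ?thesis
        unfolding normalized_comb_tail tail_error_eq[OF nz] ml_N[OF z]
        by (simp only: e1_def e2_def sign if_True)
    next
      case False
      have "z / (1 - z) * h n z = X n z * ((l - 1) / of_real \<gamma> - l / of_real \<gamma> * (1 + \<epsilon>0 n z))"
        using nz by (simp add: h_def)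
      from rearrange[OF this, of "section_error n z"] show ?thesis
        unfolding normalized_comb_section section_error_eq[OF nz] ml_N[OF z]
        by (simp only: e1_def e2_def False if_False)
    qed
  qed
  then show ?thesis
    using e1 e2 by (intro exI[of _ e1] exI[of _ e2]) (simp add: X_def \<gamma>_def)
qed

end

theorem theorem1:
  fixes \<rho> \<delta>2 \<delta>3 :: real and l :: complex
  assumes "\<rho> > 1" and "\<delta>2 > 0" and "\<delta>3 > 0"
  shows
    "(let S = {z. 1 \<le> norm z \<and> \<bar>Arg z\<bar> \<le> pi / (2 * \<rho>) \<and> \<delta>2 \<le> norm (z - 1)} in
       \<exists>e1 e2. uniform_limit S e1 (\<lambda>_. 0) sequentially \<and> uniform_limit S e2 (\<lambda>_. 0) sequentially \<and>
         (\<forall>n\<ge>1. \<forall>z\<in>S. normalized_comb \<rho> n l z =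
            - l * of_real \<rho> * exponential_term \<rho> n z * (1 + e1 n z) - z / (1 - z) * (1 + e2 n z)))
     \<and>
     (let S = {z. 0 < norm z \<and> norm z \<le> 1 \<and> \<bar>Arg z\<bar> \<le> pi / (2 * \<rho>) \<and> \<delta>2 \<le> norm (z - 1)} in
       \<exists>e1 e2. uniformly_small_off_origin (radius_scale \<rho>) S e1 \<and> uniform_limit S e2 (\<lambda>_. 0) sequentially \<and>
         (\<forall>n\<ge>1. \<forall>z\<in>S. normalized_comb \<rho> n l z =
            (1 - l) * of_real \<rho> * exponential_term \<rho> n z * (1 + e1 n z) - z / (1 - z) * (1 + e2 n z)))
     \<and>
     (let S = {z. 0 < norm z \<and> pi / (2 * \<rho>) + \<delta>3 \<le> \<bar>Arg z\<bar>} in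
       \<exists>e1 e2. uniformly_small_off_origin (radius_scale \<rho>) S e1 \<and> uniform_limit S e2 (\<lambda>_. 0) sequentially \<and>
         (\<forall>n\<ge>1. \<forall>z\<in>S. normalized_comb \<rho> n l z =
            (l - 1) / of_real (Gamma (1 - 1 / \<rho>))
              * (of_real (Gamma (1 + real n / \<rho>)) / (of_real (radius_scale \<rho> n) ^ (n + 1) * z ^ (n + 1)))
              * (1 + e1 n z) - z / (1 - z) * (1 + e2 n z)))"
  unfolding Let_def
  using assms by (intro conjI normalized_comb_sector_exterior normalized_comb_sector_interior normalized_comb_off_sector)

end
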